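(* Let $K$ be a finite field with $q$ elements and $n\ge4$. Then \[ |C_4(n)|=\begin{cases} q^{3n}-(q^3+q^2+q)q^{2n}+(q^5+q^4+q^3)q^n-q^6,&\gcd(n,4)=1,\\ q^{3n}-(q^3+q^2+q)q^{2n}+2(q^4+q^2)q^{\frac32n}-(q^5+q^4+q^3)q^n+q^6,&\gcd(n,4)=2,\\ q^{3n}+3(q^3+q^2+q)q^{2n}+2(q^4+q^2)q^{\frac32n}+3(q^5+q^4+q^3)q^n+q^6,&\gcd(n,4)=4. \end{cases} \]
   Context: $C_4(n)$ is the set of tuples $(v_1,\dots,v_n)\in(\mathbb{P}^3(K))^n$ such that for every $i\in\{1,\dots,n\}$ the points $v_i,v_{i+1},v_{i+2},v_{i+3}$ (indices mod $n$) are projectively independent, i.e. their lifts in $K^4$ are linearly independent. *)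

theory Defs
  imports "HOL-Analysis.Cartesian_Space" "HOL-Library.Numeral_Type"
begin

text \<open>Points of the projective space of \<open>K\<^sup>m\<close> are the lines through the origin; a lift of a
  point is a nonzero vector on that line.\<close>

definition proj_points :: "('a::field ^ 'm) set set" where
  "proj_points = {p. vec.subspace p \<and> vec.dim p = 1}"

definition is_lift :: "'a::field ^ 'm \<Rightarrow> ('a ^ 'm) set \<Rightarrow> bool" where
  "is_lift x p \<longleftrightarrow> x \<in> p \<and> x \<noteq> 0"

text \<open>Lifts of a point differ by a nonzero scalar, so the choice of the lifts is immaterial.
  Linear independence is that of a family, hence the distinctness condition.\<close>

definition proj_independent :: "('a::field ^ 'm) set list \<Rightarrow> bool" where
  "proj_independent ps \<longleftrightarrow>
     (\<forall>xs. list_all2 is_lift xs ps \<longrightarrow> distinct xs \<and> vec.independent (set xs))"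

text \<open>An \<open>n\<close>-tuple is a list of length \<open>n\<close>, indexed from 0.\<close>

definition C4 :: "nat \<Rightarrow> ('a::field ^ 4) set list set" where
  "C4 n = {v. length v = n \<and> set v \<subseteq> proj_points \<and>
     (\<forall>i<n. proj_independent [v ! i, v ! ((i + 1) mod n), v ! ((i + 2) mod n), v ! ((i + 3) mod n)])}"

end

theory Submission
  imports Defs "HOL-Computational_Algebra.Polynomial"
begin

text \<open>
  The subspaces spanned by \<open>v\<^sub>i\<close>, by \<open>v\<^sub>i, v\<^sub>i\<^sub>+\<^sub>1\<close> and by \<open>v\<^sub>i, v\<^sub>i\<^sub>+\<^sub>1, v\<^sub>i\<^sub>+\<^sub>2\<close> form a complete
  flag of \<open>K\<^sup>4\<close>. This identifies the tuples in \<open>C\<^sub>4(n)\<close> with the closed walks of length \<open>n\<close> on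
  complete flags whose steps have as relative position the Coxeter element \<open>s\<^sub>0 s\<^sub>1 s\<^sub>2\<close> of \<open>S\<^sub>4\<close>.
  Hence \<open>|C\<^sub>4(n)|\<close> is the trace of the \<open>n\<close>-th power of \<open>T = T\<^sub>0 T\<^sub>1 T\<^sub>2\<close>, where \<open>T\<^sub>i\<close> sums a function
  over the flags that differ in the subspace of dimension \<open>i + 1\<close> only. These operators satisfy the
  relations of the Hecke algebra of \<open>S\<^sub>4\<close>, in which \<open>T\<close> is annihilated by a polynomial of degree 10.
  The trace of \<open>T\<^sup>n\<close> is the number of flags times the coordinate of \<open>T\<^sup>n\<close> at the identity. So both
  sides of the claim satisfy the same linear recurrence of order 10, and it remains to compare ten
  initial values.
\<close>

section \<open>Subspaces of a finite vector space\<close>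

lemma card_span_insert:
  fixes a :: "'a::{field,finite} ^ 'n"
  assumes a: "a \<notin> vec.span B"
  shows "card (vec.span (insert a B)) = CARD('a) * card (vec.span B)"
proof -
  have "vec.span (insert a B) = (\<lambda>(k, s). k *s a + s) ` (UNIV \<times> vec.span B)"
  proof (intro equalityI subsetI)
    fix x assume "x \<in> vec.span (insert a B)"
    then obtain k where "x - k *s a \<in> vec.span B" by (auto simp: vec.span_insert)
    then show "x \<in> (\<lambda>(k, s). k *s a + s) ` (UNIV \<times> vec.span B)"
      by (intro image_eqI[of _ _ "(k, x - k *s a)"]) auto
  qed (auto simp: vec.span_insert, metis add_diff_cancel_left')
  moreover have "inj_on (\<lambda>(k, s). k *s a + s) (UNIV \<times> vec.span B)"
  proof (clarsimp simp: inj_on_def)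
    fix k s k' s'
    assume s: "s \<in> vec.span B" "s' \<in> vec.span B" and eq: "k *s a + s = k' *s a + s'"
    have diff: "(k - k') *s a = s' - s"
      using eq by (simp add: vec.scale_left_diff_distrib algebra_simps)
    have "k = k'"
    proof (rule ccontr)
      assume "k \<noteq> k'"
      then have "a = inverse (k - k') *s (s' - s)"
        by (simp flip: diff)
      with a s show False by (simp add: vec.span_diff vec.span_scale)
    qed
    with eq show "k = k' \<and> s = s'" by simp
  qed
  ultimately show ?thesis
    by (simp add: card_image card_cartesian_product)
qed

lemma card_span_independent:
  fixes B :: "('a::{field,finite} ^ 'n) set"
  assumes "vec.independent B"
  shows "card (vec.span B) = CARD('a) ^ card B"
  using finite[of B] assms
  by (induction B rule: finite_induct)
    (auto simp: vec.independent_insert card_span_insert split: if_splits)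

lemma card_subspace:
  fixes S :: "('a::{field,finite} ^ 'n) set"
  assumes "vec.subspace S"
  shows "card S = CARD('a) ^ vec.dim S"
proof -
  obtain B where B: "B \<subseteq> S" "vec.independent B" "S \<subseteq> vec.span B" "card B = vec.dim S"
    by (rule vec.basis_exists)
  then have "S = vec.span B"
    using assms by (metis vec.span_minimal subset_antisym)
  with B show ?thesis by (metis card_span_independent)
qed

lemma span_Un_span: "vec.span (vec.span A \<union> vec.span B) = vec.span (A \<union> B)"
  by (simp only: vec.span_Un vec.span_span)

lemma dim_Un_Int:
  assumes "vec.subspace A" "vec.subspace B"
  shows "vec.dim (A \<union> B) + vec.dim (A \<inter> B) = vec.dim A + vec.dim B"
proof -
  have "vec.span A = A" "vec.span B = B"
    using assms by auto
  then have "vec.span (A \<union> B) = {x + y |x y. x \<in> A \<and> y \<in> B}"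
    by (simp only: vec.span_Un)
  then have "vec.dim (A \<union> B) = vec.dim {x + y |x y. x \<in> A \<and> y \<in> B}"
    by (metis vec.dim_span)
  then show ?thesis
    using vec.dim_sums_Int[OF assms] by simp
qed

lemma dim_Un_le: "vec.dim (A \<union> B) \<le> vec.dim A + vec.dim (B :: ('a::field ^ 'n) set)"
proof -
  have "vec.dim (vec.span A \<union> vec.span B) \<le> vec.dim (vec.span A) + vec.dim (vec.span B)"
    using dim_Un_Int[OF vec.subspace_span vec.subspace_span, of A B] by linarith
  then show ?thesis by (metis span_Un_span vec.dim_span)
qed

lemma dim_Int_less:
  fixes A B :: "('a::field ^ 'n) set"
  assumes "vec.subspace A" "vec.subspace B" "vec.dim A = vec.dim B" "A \<noteq> B"
  shows "vec.dim (A \<inter> B) < vec.dim A"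
proof (rule vec.dim_psubset)
  have "A \<inter> B \<subset> A"
    using assms vec.subspace_dim_equal[of A B] by auto
  then show "vec.span (A \<inter> B) \<subset> vec.span A"
    using assms(1,2) by (metis vec.span_eq_iff vec.subspace_inter)
qed

lemma subspace_dim_0: "vec.subspace A \<Longrightarrow> vec.dim A = 0 \<Longrightarrow> A = {0::'a::field ^ 'n}"
  using vec.subspace_0[of A] vec.dim_eq_0[of A] by blast

lemma subspace_dim_CARD:
  "vec.subspace A \<Longrightarrow> vec.dim A = CARD('n) \<Longrightarrow> A = (UNIV :: ('a::field ^ 'n) set)"
  by (rule vec.subspace_dim_equal) (auto simp: card_cart_basis)

definition between :: "('a::field ^ 'n) set \<Rightarrow> ('a ^ 'n) set \<Rightarrow> nat \<Rightarrow> ('a ^ 'n) set set" where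
  "between A B d = {C. vec.subspace C \<and> A \<subseteq> C \<and> C \<subseteq> B \<and> vec.dim C = d}"

lemma span_insert_eq_of_between:
  assumes A: "vec.subspace A" and C: "C \<in> between A B (Suc (vec.dim A))" and v: "v \<in> C - A"
  shows "vec.span (insert v A) = C"
proof (rule vec.subspace_dim_equal)
  show "vec.span (insert v A) \<subseteq> C"
    using C v by (intro vec.span_minimal) (auto simp: between_def)
  have "v \<notin> vec.span A" using v A by (metis DiffD2 vec.span_eq_iff)
  then show "vec.dim C \<le> vec.dim (vec.span (insert v A))"
    using C by (auto simp: between_def vec.dim_insert)
qed (use C in \<open>auto simp: between_def\<close>)

lemma Diff_eq_UN_between:
  assumes A: "vec.subspace A" and B: "vec.subspace B" and AB: "A \<subseteq> B"
  shows "B - A = (\<Union>C\<in>between A B (Suc (vec.dim A)). C - A)"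
proof (intro equalityI subsetI)
  fix v assume v: "v \<in> B - A"
  then have "v \<notin> vec.span A" using A by (metis DiffD2 vec.span_eq_iff)
  moreover have "vec.span (insert v A) \<subseteq> B"
    using v AB B by (intro vec.span_minimal) auto
  ultimately have "vec.span (insert v A) \<in> between A B (Suc (vec.dim A))"
    using vec.span_superset[of "insert v A"] by (auto simp: between_def vec.dim_insert)
  with v show "v \<in> (\<Union>C\<in>between A B (Suc (vec.dim A)). C - A)"
    using vec.span_superset[of "insert v A"] by blast
qed (auto simp: between_def)

lemma card_between:
  fixes A B :: "('a::{field,finite} ^ 'n) set"
  assumes A: "vec.subspace A" and B: "vec.subspace B" and AB: "A \<subseteq> B"
    and dim: "vec.dim B = vec.dim A + m"
  shows "card (between A B (Suc (vec.dim A))) = (\<Sum>i<m. CARD('a) ^ i)"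
proof -
  let ?N = "between A B (Suc (vec.dim A))" and ?q = "int CARD('a)"
  have card_Diff: "int (card (C - A)) = ?q ^ vec.dim A * (?q ^ d - 1)"
    if "vec.subspace C" "A \<subseteq> C" "vec.dim C = vec.dim A + d" for C d
    using that A by (simp add: card_Diff_subset card_subspace of_nat_diff card_mono
        power_increasing power_add algebra_simps flip: of_nat_power)
  have "card {0::'a, 1} \<le> CARD('a)" by (intro card_mono) auto
  then have q: "?q > 1" by simp
  have "card (B - A) = (\<Sum>C\<in>?N. card (C - A))"
    unfolding Diff_eq_UN_between[OF A B AB]
  proof (rule card_UN_disjoint)
    show "\<forall>C\<in>?N. \<forall>D\<in>?N. C \<noteq> D \<longrightarrow> (C - A) \<inter> (D - A) = {}"
      using span_insert_eq_of_between[OF A] by blast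
  qed auto
  then have "int (card (B - A)) = (\<Sum>C\<in>?N. ?q ^ vec.dim A * (?q - 1))"
    using card_Diff[where d = 1] by (simp add: between_def)
  then have "?q ^ m - 1 = int (card ?N) * (?q - 1)"
    using card_Diff[OF B AB dim] q by simp
  then have "int (card ?N) = (\<Sum>i<m. ?q ^ i)"
    using q by (simp add: power_diff_1_eq mult.commute)
  then have "int (card ?N) = int (\<Sum>i<m. CARD('a) ^ i)"
    by simp
  then show ?thesis by (simp only: of_nat_eq_iff)
qed

section \<open>Projective planes\<close>

text \<open>Degenerate planes are allowed.\<close>
locale projective_plane =
  fixes points :: "'p set" and lines :: "'l set" and incident :: "'p \<Rightarrow> 'l \<Rightarrow> bool"
  assumes finite_points: "finite points" and finite_lines: "finite lines"
    and join: "\<lbrakk>x \<in> points; y \<in> points; x \<noteq> y\<rbrakk>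
      \<Longrightarrow> \<exists>!l. l \<in> lines \<and> incident x l \<and> incident y l"
    and meet: "\<lbrakk>l \<in> lines; k \<in> lines; l \<noteq> k\<rbrakk>
      \<Longrightarrow> \<exists>!x. x \<in> points \<and> incident x l \<and> incident x k"
begin

definition points_on :: "'l \<Rightarrow> 'p set" where
  "points_on l = {x \<in> points. incident x l}"

definition lines_through :: "'p \<Rightarrow> 'l set" where
  "lines_through x = {l \<in> lines. incident x l}"

lemma mem_points_on [simp]: "x \<in> points_on l \<longleftrightarrow> x \<in> points \<and> incident x l"
  by (simp add: points_on_def)

lemma mem_lines_through [simp]: "l \<in> lines_through x \<longleftrightarrow> l \<in> lines \<and> incident x l"
  by (simp add: lines_through_def)

definition intersection :: "'l \<Rightarrow> 'l \<Rightarrow> 'p" where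
  "intersection l k = (THE x. x \<in> points \<and> incident x l \<and> incident x k)"

definition galleries :: "'p \<Rightarrow> 'l \<Rightarrow> ('p \<times> 'l \<times> 'p) set" where
  "galleries x l =
     (SIGMA x':points_on l - {x}. SIGMA l':lines_through x' - {l}. points_on l' - {x'})"

definition opposite_flags :: "'p \<Rightarrow> 'l \<Rightarrow> ('p \<times> 'l) set" where
  "opposite_flags x l =
     {(y, k). y \<in> points \<and> k \<in> lines \<and> incident y k \<and> \<not> incident y l \<and> \<not> incident x k}"

lemma dual: "projective_plane lines points (\<lambda>l x. incident x l)"
  by unfold_locales (use finite_points finite_lines join meet in auto)

lemma intersection_in_points:
  assumes "l \<in> lines" "k \<in> lines" "l \<noteq> k"
  shows "intersection l k \<in> points" "incident (intersection l k) l" "incident (intersection l k) k"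
  using theI'[OF meet[OF assms]] by (simp_all add: intersection_def)

lemma intersection_eq:
  assumes "l \<in> lines" "k \<in> lines" "l \<noteq> k" and "x \<in> points" "incident x l" "incident x k"
  shows "intersection l k = x"
  unfolding intersection_def by (rule the1_equality) (use meet assms in auto)

lemma bij_betw_galleries_opposite_flags:
  assumes x: "x \<in> points" and l: "l \<in> lines" and xl: "incident x l"
  shows "bij_betw (\<lambda>(x', l', y). (y, l')) (galleries x l) (opposite_flags x l)"
proof (rule bij_betw_byWitness[where f' = "\<lambda>(y, k). (intersection l k, k, y)"])
  show "\<forall>t\<in>galleries x l.
      (\<lambda>(y, k). (intersection l k, k, y)) ((\<lambda>(x', l', y). (y, l')) t) = t"
    by (auto simp: galleries_def intersection_eq[OF l])
  show "(\<lambda>(x', l', y). (y, l')) ` galleries x l \<subseteq> opposite_flags x l"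
  proof (rule image_subsetI)
    fix t assume "t \<in> galleries x l"
    then obtain x' l' y where t: "t = (x', l', y)"
      and x': "x' \<in> points" "incident x' l" "x' \<noteq> x"
      and l': "l' \<in> lines" "incident x' l'" "l' \<noteq> l"
      and y: "y \<in> points" "incident y l'" "y \<noteq> x'"
      by (auto simp: galleries_def points_on_def lines_through_def)
    have "\<not> incident y l" "\<not> incident x l'"
      using intersection_eq[OF l l'(1)] x x' xl l' y by metis+
    with t l' y show "(\<lambda>(x', l', y). (y, l')) t \<in> opposite_flags x l"
      by (simp add: opposite_flags_def)
  qed
  show "(\<lambda>(y, k). (intersection l k, k, y)) ` opposite_flags x l \<subseteq> galleries x l"
  proof (rule image_subsetI)
    fix t assume "t \<in> opposite_flags x l"
    then obtain y k where t: "t = (y, k)" and y: "y \<in> points" "\<not> incident y l"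
      and k: "k \<in> lines" "\<not> incident x k" "incident y k"
      by (auto simp: opposite_flags_def)
    moreover have "l \<noteq> k" using k xl by auto
    ultimately show "(\<lambda>(y, k). (intersection l k, k, y)) t \<in> galleries x l"
      using intersection_in_points[OF l k(1)] by (auto simp: galleries_def)
  qed
qed (auto simp: opposite_flags_def)

lemma sum_opposite_flags:
  assumes "x \<in> points" "l \<in> lines" "incident x l"
  shows "(\<Sum>x'\<in>points_on l - {x}. \<Sum>l'\<in>lines_through x' - {l}. \<Sum>y\<in>points_on l' - {x'}. g y l')
       = (\<Sum>(y, k)\<in>opposite_flags x l. g y k)"
proof -
  have "(\<Sum>x'\<in>points_on l - {x}. \<Sum>l'\<in>lines_through x' - {l}. \<Sum>y\<in>points_on l' - {x'}. g y l')
      = (\<Sum>(x', l', y)\<in>galleries x l. g y l')"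
    by (simp add: galleries_def sum.Sigma points_on_def lines_through_def
        finite_points finite_lines)
  also have "\<dots> = (\<Sum>(y, k)\<in>opposite_flags x l. g y k)"
    using sum.reindex_bij_betw[OF bij_betw_galleries_opposite_flags[OF assms], of "case_prod g"]
    by (simp add: case_prod_unfold)
  finally show ?thesis .
qed

lemma sum_galleries_braid:
  assumes x: "x \<in> points" and l: "l \<in> lines" and xl: "incident x l"
  shows "(\<Sum>x'\<in>points_on l - {x}. \<Sum>l'\<in>lines_through x' - {l}. \<Sum>y\<in>points_on l' - {x'}. g y l')
       = (\<Sum>l'\<in>lines_through x - {l}. \<Sum>x'\<in>points_on l' - {x}. \<Sum>k\<in>lines_through x' - {l'}. g x' k)"
proof -
  interpret dual: projective_plane lines points "\<lambda>l x. incident x l"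
    by (rule dual)
  have "dual.opposite_flags l x = prod.swap ` opposite_flags x l"
    by (auto simp: opposite_flags_def dual.opposite_flags_def)
  then have "(\<Sum>(k, y)\<in>dual.opposite_flags l x. g y k) = (\<Sum>(y, k)\<in>opposite_flags x l. g y k)"
    by (simp add: sum.reindex case_prod_unfold)
  moreover have "dual.points_on = lines_through" "dual.lines_through = points_on"
    by (auto simp: points_on_def lines_through_def dual.points_on_def dual.lines_through_def)
  ultimately show ?thesis
    using sum_opposite_flags[OF assms] dual.sum_opposite_flags[OF l x xl, of "\<lambda>k y. g y k"] by simp
qed

end

lemma ex1_join_between:
  fixes A B :: "('a::field ^ 'n) set"
  assumes B: "vec.subspace B" and X: "X \<in> between A B (Suc (vec.dim A))"
    and Y: "Y \<in> between A B (Suc (vec.dim A))" and "X \<noteq> Y"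
  shows "\<exists>!Z. Z \<in> between A B (Suc (Suc (vec.dim A))) \<and> X \<subseteq> Z \<and> Y \<subseteq> Z"
proof -
  have "vec.dim A \<le> vec.dim (X \<inter> Y)"
    using X Y by (intro vec.dim_subset) (auto simp: between_def)
  moreover have "vec.dim (X \<inter> Y) < vec.dim X"
    using X Y \<open>X \<noteq> Y\<close> by (intro dim_Int_less) (auto simp: between_def)
  ultimately have dim_join: "vec.dim (X \<union> Y) = Suc (Suc (vec.dim A))"
    using dim_Un_Int[of X Y] X Y by (simp add: between_def)
  moreover have "vec.span (X \<union> Y) \<subseteq> B"
    using X Y B by (intro vec.span_minimal) (auto simp: between_def)
  ultimately have "vec.span (X \<union> Y) \<in> between A B (Suc (Suc (vec.dim A)))"
    using X vec.span_superset[of "X \<union> Y"] by (auto simp: between_def)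
  moreover have "Z = vec.span (X \<union> Y)"
    if "Z \<in> between A B (Suc (Suc (vec.dim A))) \<and> X \<subseteq> Z \<and> Y \<subseteq> Z" for Z
    using that dim_join by (intro vec.subspace_dim_equal[symmetric] vec.span_minimal)
      (auto simp: between_def)
  ultimately show ?thesis
    using vec.span_superset[of "X \<union> Y"] by blast
qed

lemma ex1_meet_between:
  fixes A B :: "('a::field ^ 'n) set"
  assumes dim: "vec.dim B = vec.dim A + 3" and X: "X \<in> between A B (Suc (Suc (vec.dim A)))"
    and Y: "Y \<in> between A B (Suc (Suc (vec.dim A)))" and "X \<noteq> Y"
  shows "\<exists>!Z. Z \<in> between A B (Suc (vec.dim A)) \<and> Z \<subseteq> X \<and> Z \<subseteq> Y"
proof -
  have "vec.dim (X \<union> Y) \<le> vec.dim B"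
    using X Y by (intro vec.dim_subset) (auto simp: between_def)
  moreover have "vec.dim (X \<inter> Y) < vec.dim X"
    using X Y \<open>X \<noteq> Y\<close> by (intro dim_Int_less) (auto simp: between_def)
  ultimately have dim_meet: "vec.dim (X \<inter> Y) = Suc (vec.dim A)"
    using dim_Un_Int[of X Y] X Y dim by (simp add: between_def)
  then have "X \<inter> Y \<in> between A B (Suc (vec.dim A))"
    using X Y by (auto simp: between_def vec.subspace_inter)
  moreover have "Z = X \<inter> Y"
    if "Z \<in> between A B (Suc (vec.dim A)) \<and> Z \<subseteq> X \<and> Z \<subseteq> Y" for Z
    using that X Y dim_meet
    by (intro vec.subspace_dim_equal) (auto simp: between_def vec.subspace_inter)
  ultimately show ?thesis by blast
qed

lemma projective_plane_between:
  fixes A B :: "('a::{field,finite} ^ 'n) set"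
  assumes "vec.subspace B" "vec.dim B = vec.dim A + 3"
  shows "projective_plane (between A B (Suc (vec.dim A))) (between A B (Suc (Suc (vec.dim A)))) (\<subseteq>)"
  using assms by unfold_locales (simp_all add: ex1_join_between ex1_meet_between)

lemma sum_between_braid:
  fixes A B :: "('a::{field,finite} ^ 'n) set" and g :: "_ \<Rightarrow> _ \<Rightarrow> 'b::comm_monoid_add"
  assumes dim_A: "vec.dim A = d" and B: "vec.subspace B" "vec.dim B = d + 3"
    and X: "X \<in> between A B (Suc d)" and Y: "Y \<in> between X B (Suc (Suc d))"
  shows "(\<Sum>X'\<in>between A Y (Suc d) - {X}. \<Sum>Y'\<in>between X' B (Suc (Suc d)) - {Y}.
      \<Sum>X''\<in>between A Y' (Suc d) - {X'}. g X'' Y')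
    = (\<Sum>Y'\<in>between X B (Suc (Suc d)) - {Y}. \<Sum>X'\<in>between A Y' (Suc d) - {X}.
      \<Sum>Y''\<in>between X' B (Suc (Suc d)) - {Y'}. g X' Y'')"
proof -
  interpret projective_plane "between A B (Suc d)" "between A B (Suc (Suc d))" "(\<subseteq>)"
    using projective_plane_between[OF B(1), of A] B(2) dim_A by simp
  have "between A Z (Suc d) = points_on Z" if "Z \<in> between A B (Suc (Suc d))" for Z
    using that unfolding points_on_def by (auto simp: between_def)
  moreover have "between Z B (Suc (Suc d)) = lines_through Z" if "Z \<in> between A B (Suc d)" for Z
    using that unfolding lines_through_def by (auto simp: between_def)
  moreover have "Y \<in> between A B (Suc (Suc d))" and "X \<subseteq> Y"
    using X Y by (auto simp: between_def)
  ultimately show ?thesis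
    using sum_galleries_braid[OF X, of Y g] X by simp
qed

section \<open>Closed walks\<close>

definition walks :: "('f \<Rightarrow> 'f set) \<Rightarrow> nat \<Rightarrow> 'f \<Rightarrow> 'f \<Rightarrow> 'f list set" where
  "walks S n F G =
     {w. length w = n \<and> hd (w @ [G]) = F \<and> successively (\<lambda>A B. B \<in> S A) (w @ [G])}"

definition closed_walks :: "'f set \<Rightarrow> ('f \<Rightarrow> 'f set) \<Rightarrow> nat \<Rightarrow> 'f list set" where
  "closed_walks V S n =
     {w. length w = n \<and> set w \<subseteq> V \<and> (\<forall>i. w ! (Suc i mod n) \<in> S (w ! (i mod n)))}"

definition point_mass :: "'f \<Rightarrow> 'f \<Rightarrow> int" where
  "point_mass F G = of_bool (G = F)"

definition trace_on :: "'f set \<Rightarrow> (('f \<Rightarrow> int) \<Rightarrow> 'f \<Rightarrow> int) \<Rightarrow> int" where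
  "trace_on V T = (\<Sum>F\<in>V. T (point_mass F) F)"

lemma successively_append_hd_iff:
  assumes w: "w \<noteq> []"
  shows "successively P (w @ [hd w])
    \<longleftrightarrow> (\<forall>i. P (w ! (i mod length w)) (w ! (Suc i mod length w)))"
proof -
  let ?n = "length w"
  have "(w @ [hd w]) ! i = w ! i" "(w @ [hd w]) ! Suc i = w ! (Suc i mod ?n)" if "i < ?n" for i
    using that w by (auto simp: nth_append hd_conv_nth mod_Suc)
  then have "successively P (w @ [hd w]) \<longleftrightarrow> (\<forall>i<?n. P (w ! i) (w ! (Suc i mod ?n)))"
    by (auto simp: successively_conv_nth)
  also have "\<dots> \<longleftrightarrow> (\<forall>i. P (w ! (i mod ?n)) (w ! (Suc i mod ?n)))"
    using w by (metis length_greater_0_conv mod_Suc_eq mod_less mod_less_divisor)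
  finally show ?thesis .
qed

lemma walks_0: "walks S 0 F G = (if F = G then {[]} else {})"
  by (auto simp: walks_def)

lemma walks_Suc: "walks S (Suc n) F G = (#) F ` (\<Union>H\<in>S F. walks S n H G)"
proof (intro equalityI subsetI)
  fix w assume "w \<in> walks S (Suc n) F G"
  then obtain v where "w = F # v" "length v = n" "successively (\<lambda>A B. B \<in> S A) (F # v @ [G])"
    by (cases w) (auto simp: walks_def)
  then show "w \<in> (#) F ` (\<Union>H\<in>S F. walks S n H G)"
    by (auto simp: walks_def successively_Cons)
qed (auto simp: walks_def successively_Cons)

context
  fixes V :: "'f set" and S :: "'f \<Rightarrow> 'f set"
  assumes finite_V: "finite V" and S_subset: "\<And>F. F \<in> V \<Longrightarrow> S F \<subseteq> V"
begin

lemma walks_subset_lists: "F \<in> V \<Longrightarrow> walks S n F G \<subseteq> {w. set w \<subseteq> V \<and> length w = n}"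
proof (induction n arbitrary: F)
  case (Suc n)
  then show ?case using S_subset[OF Suc.prems] by (force simp: walks_Suc)
qed (simp add: walks_0)

lemma finite_walks: "F \<in> V \<Longrightarrow> finite (walks S n F G)"
  by (rule finite_subset[OF walks_subset_lists finite_lists_length_eq[OF finite_V]])

lemma card_walks:
  fixes T :: "('f \<Rightarrow> int) \<Rightarrow> 'f \<Rightarrow> int"
  assumes T: "\<And>g F. F \<in> V \<Longrightarrow> T g F = (\<Sum>G\<in>S F. g G)" and F: "F \<in> V"
  shows "(T ^^ n) (point_mass G) F = int (card (walks S n F G))"
  using F
proof (induction n arbitrary: F)
  case 0
  then show ?case by (simp add: walks_0 point_mass_def)
next
  case (Suc n)
  have fin: "finite (S F)" "\<forall>H\<in>S F. finite (walks S n H G)"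
    using S_subset[OF Suc.prems] by (auto intro: finite_subset[OF _ finite_V] finite_walks)
  have disjoint: "\<forall>H\<in>S F. \<forall>H'\<in>S F. H \<noteq> H' \<longrightarrow> walks S n H G \<inter> walks S n H' G = {}"
    by (auto simp: walks_def)
  have "(T ^^ Suc n) (point_mass G) F = (\<Sum>H\<in>S F. int (card (walks S n H G)))"
    using Suc.IH S_subset[OF Suc.prems] by (auto simp: T[OF Suc.prems] intro!: sum.cong)
  also have "\<dots> = int (card (\<Union>H\<in>S F. walks S n H G))"
    using card_UN_disjoint[OF fin disjoint] by simp
  also have "\<dots> = int (card (walks S (Suc n) F G))"
    by (simp add: walks_Suc card_image)
  finally show ?case .
qed

lemma mem_closed_walks_iff:
  assumes n: "n > 0"
  shows "w \<in> closed_walks V S n \<longleftrightarrow> (\<exists>F\<in>V. w \<in> walks S n F F)"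
proof
  assume w: "w \<in> closed_walks V S n"
  then have "w \<noteq> []" and len: "length w = n"
    using n by (auto simp: closed_walks_def)
  then have "hd w \<in> V" "w \<in> walks S n (hd w) (hd w)"
    using w successively_append_hd_iff[OF \<open>w \<noteq> []\<close>] by (auto simp: closed_walks_def walks_def)
  then show "\<exists>F\<in>V. w \<in> walks S n F F" by blast
next
  assume "\<exists>F\<in>V. w \<in> walks S n F F"
  then obtain F where F: "F \<in> V" "w \<in> walks S n F F" by blast
  then have "w \<noteq> []" and "hd w = F"
    using n by (cases w; auto simp: walks_def)+
  moreover have "set w \<subseteq> V" "length w = n"
    using walks_subset_lists[OF F(1)] F(2) by blast+
  ultimately show "w \<in> closed_walks V S n"
    using F successively_append_hd_iff[of w] by (auto simp: closed_walks_def walks_def)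
qed

lemma card_closed_walks:
  fixes T :: "('f \<Rightarrow> int) \<Rightarrow> 'f \<Rightarrow> int"
  assumes T: "\<And>g F. F \<in> V \<Longrightarrow> T g F = (\<Sum>G\<in>S F. g G)" and n: "n > 0"
  shows "int (card (closed_walks V S n)) = trace_on V (T ^^ n)"
proof -
  have "closed_walks V S n = (\<Union>F\<in>V. walks S n F F)"
    using mem_closed_walks_iff[OF n] by auto
  moreover have "\<forall>F\<in>V. \<forall>G\<in>V. F \<noteq> G \<longrightarrow> walks S n F F \<inter> walks S n G G = {}"
    using n by (auto simp: walks_def)
  ultimately have "int (card (closed_walks V S n)) = (\<Sum>F\<in>V. int (card (walks S n F F)))"
    by (simp add: card_UN_disjoint finite_V finite_walks)
  then show ?thesis
    by (simp add: trace_on_def card_walks[OF T])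
qed

end

section \<open>Complete flags\<close>

type_synonym ('a, 'n) flag = "nat \<Rightarrow> ('a ^ 'n) set"

definition flags :: "('a::{field,finite}, 'n::finite) flag set" where
  "flags = {F. mono F \<and> (\<forall>i. vec.subspace (F i) \<and> vec.dim (F i) = min i CARD('n))}"

lemma flags_0: "F \<in> flags \<Longrightarrow> F 0 = {0}"
  by (rule subspace_dim_0) (simp_all add: flags_def)

lemma flags_UNIV:
  fixes F :: "('a::{field,finite}, 'n::finite) flag"
  assumes "F \<in> flags" "CARD('n) \<le> i"
  shows "F i = UNIV"
  using assms by (intro subspace_dim_CARD) (simp_all add: flags_def)

lemma flags_subset: "F \<in> flags \<Longrightarrow> i \<le> j \<Longrightarrow> F i \<subseteq> F j"
  by (simp add: flags_def monoD)

definition partial_flags :: "nat \<Rightarrow> ('a::{field,finite}, 'n::finite) flag set" where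
  "partial_flags k =
     {F. mono F \<and> (\<forall>i. vec.subspace (F i) \<and> vec.dim (F i) = (if i \<le> k then i else CARD('n)))}"

lemma partial_flags_0:
  "(partial_flags 0 :: ('a::{field,finite}, 'n::finite) flag set)
    = {\<lambda>i. if i = 0 then {0} else UNIV}"
proof (intro equalityI subsetI)
  fix F :: "('a, 'n) flag" assume F: "F \<in> partial_flags 0"
  have "F i = (if i = 0 then {0} else UNIV)" for i
    using F subspace_dim_0[of "F i"] subspace_dim_CARD[of "F i"] by (auto simp: partial_flags_def)
  then show "F \<in> {\<lambda>i. if i = 0 then {0} else UNIV}" by auto
qed (auto simp: partial_flags_def mono_def vec.subspace_0 vec.subspace_single_0 card_cart_basis)

lemma partial_flags_UNIV:
  fixes F :: "('a::{field,finite}, 'n::finite) flag"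
  assumes "F \<in> partial_flags k" "k < i"
  shows "F i = UNIV"
  using assms by (intro subspace_dim_CARD) (simp_all add: partial_flags_def)

lemma bij_betw_partial_flags_Suc:
  assumes k: "k < CARD('n)"
  shows "bij_betw (\<lambda>(F, X). F(Suc k := X)) (SIGMA F:partial_flags k. between (F k) UNIV (Suc k))
    (partial_flags (Suc k) :: ('a::{field,finite}, 'n::finite) flag set)"
    (is "bij_betw ?upd ?extensions _")
proof (rule bij_betw_byWitness[where f' = "\<lambda>F. (F(Suc k := UNIV), F (Suc k))"])
  show "\<forall>p\<in>?extensions. ((?upd p)(Suc k := UNIV), ?upd p (Suc k)) = p"
    by (auto simp: fun_eq_iff partial_flags_UNIV)
  show "?upd ` ?extensions \<subseteq> partial_flags (Suc k)"
  proof clarify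
    fix F :: "('a, 'n) flag" and X
    assume F: "F \<in> partial_flags k" and X: "X \<in> between (F k) UNIV (Suc k)"
    then show "F(Suc k := X) \<in> partial_flags (Suc k)"
      using partial_flags_UNIV[OF F]
      by (auto simp: partial_flags_def between_def mono_iff_le_Suc card_cart_basis)
  qed
  show "(\<lambda>F. (F(Suc k := UNIV), F (Suc k))) ` partial_flags (Suc k) \<subseteq> ?extensions"
  proof clarify
    fix F :: "('a, 'n) flag" assume F: "F \<in> partial_flags (Suc k)"
    with k show "F(Suc k := UNIV) \<in> partial_flags k \<and>
        F (Suc k) \<in> between ((F(Suc k := UNIV)) k) UNIV (Suc k)"
      using partial_flags_UNIV[OF F]
      by (auto simp: partial_flags_def between_def mono_iff_le_Suc card_cart_basis)
  qed
qed auto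

lemma finite_card_partial_flags:
  assumes "k \<le> CARD('n)"
  shows "finite (partial_flags k :: ('a::{field,finite}, 'n::finite) flag set) \<and>
    card (partial_flags k :: ('a, 'n) flag set) = (\<Prod>i<k. \<Sum>j<CARD('n) - i. CARD('a) ^ j)"
  using assms
proof (induction k)
  case 0
  then show ?case by (simp add: partial_flags_0)
next
  case (Suc k)
  have between: "card (between (F k) UNIV (Suc k)) = (\<Sum>j<CARD('n) - k. CARD('a) ^ j)"
    if "F \<in> partial_flags k" for F :: "('a, 'n) flag"
    using that Suc.prems card_between[of "F k" UNIV "CARD('n) - k"]
    by (auto simp: partial_flags_def card_cart_basis)
  have bij: "bij_betw (\<lambda>(F, X). F(Suc k := X)) (SIGMA F:partial_flags k. between (F k) UNIV (Suc k))
    (partial_flags (Suc k) :: ('a, 'n) flag set)"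
    using Suc.prems by (intro bij_betw_partial_flags_Suc) simp
  show ?case
    using Suc bij_betw_finite[OF bij] bij_betw_same_card[OF bij, symmetric]
    by (simp add: between)
qed

lemma flags_eq_partial_flags:
  "(flags :: ('a::{field,finite}, 'n::finite) flag set) = partial_flags CARD('n)"
  by (auto simp: flags_def partial_flags_def min_def)

lemma finite_flags: "finite (flags :: ('a::{field,finite}, 'n::finite) flag set)"
  by (simp add: flags_eq_partial_flags finite_card_partial_flags)

lemma card_flags:
  "card (flags :: ('a::{field,finite}, 'n::finite) flag set) =
     (\<Prod>i<CARD('n). \<Sum>j<CARD('n) - i. CARD('a) ^ j)"
  by (simp add: flags_eq_partial_flags finite_card_partial_flags)

definition panel :: "nat \<Rightarrow> ('a::field, 'n::finite) flag \<Rightarrow> ('a ^ 'n) set set" where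
  "panel i F = between (F i) (F (Suc (Suc i))) (Suc i)"

text \<open>Off the set of flags \<open>move i\<close> is multiplication by \<open>q\<close>, so that the Hecke relations hold
  for all functions.\<close>
definition move ::
    "nat \<Rightarrow> (('a::{field,finite}, 'n::finite) flag \<Rightarrow> int) \<Rightarrow> ('a, 'n) flag \<Rightarrow> int" where
  "move i g F = (if F \<in> flags then \<Sum>X\<in>panel i F - {F (Suc i)}. g (F(Suc i := X))
     else int CARD('a) * g F)"

lemma flag_upd_panel:
  fixes F :: "('a::{field,finite}, 'n::finite) flag"
  assumes F: "F \<in> flags" and X: "X \<in> panel i F"
  shows "F(Suc i := X) \<in> flags"
  using F X dim_subset_UNIV_cart_gen[of X]
  by (auto simp: flags_def panel_def between_def mono_iff_le_Suc)

lemma flag_in_panel: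
  fixes F :: "('a::{field,finite}, 'n::finite) flag"
  assumes "F \<in> flags" "Suc i < CARD('n)"
  shows "F (Suc i) \<in> panel i F"
  using assms flags_subset[OF assms(1)] by (simp add: flags_def panel_def between_def)

lemma card_panel:
  fixes F :: "('a::{field,finite}, 'n::finite) flag"
  assumes "F \<in> flags" "Suc i < CARD('n)"
  shows "int (card (panel i F)) = int CARD('a) + 1"
proof -
  have "vec.dim (F i) = i" "vec.dim (F (Suc (Suc i))) = i + 2"
    "vec.subspace (F i)" "vec.subspace (F (Suc (Suc i)))" "F i \<subseteq> F (Suc (Suc i))"
    using assms flags_subset[OF assms(1), of i "Suc (Suc i)"] by (simp_all add: flags_def)
  then have "card (panel i F) = (\<Sum>j<2. CARD('a) ^ j)"
    using card_between[of "F i" "F (Suc (Suc i))" 2] by (simp add: panel_def)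
  then show ?thesis by (simp add: numeral_2_eq_2)
qed

lemma panel_upd [simp]:
  "panel i (F(Suc i := X)) = panel i F"
  "i \<noteq> Suc j \<Longrightarrow> j \<noteq> Suc i \<Longrightarrow> panel j (F(Suc i := X)) = panel j F"
  "panel (Suc i) (F(Suc i := X)) = between X (F (Suc (Suc (Suc i)))) (Suc (Suc i))"
  "panel i (F(Suc (Suc i) := X)) = between (F i) X (Suc i)"
  by (auto simp: panel_def)

lemma sum_sum_Diff_singleton:
  fixes g :: "'b \<Rightarrow> 'c::comm_ring_1"
  assumes "finite M" "x \<in> M" "of_nat (card M) = q + 1"
  shows "(\<Sum>y\<in>M - {x}. \<Sum>z\<in>M - {y}. g z) = (q - 1) * (\<Sum>y\<in>M - {x}. g y) + q * g x"
proof -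
  have "(\<Sum>y\<in>M - {x}. \<Sum>z\<in>M - {y}. g z) = (\<Sum>y\<in>M - {x}. (\<Sum>z\<in>M - {x}. g z) + g x - g y)"
    using assms by (intro sum.cong) (auto simp: sum_diff1)
  also have "\<dots> = of_nat (card (M - {x})) * ((\<Sum>z\<in>M - {x}. g z) + g x) - (\<Sum>y\<in>M - {x}. g y)"
    by (simp add: sum_subtractf)
  also have "of_nat (card (M - {x})) = q"
    using assms(3) card_Suc_Diff1[OF assms(1,2)] by (metis add.commute add_left_cancel of_nat_Suc)
  finally show ?thesis by (simp add: algebra_simps)
qed

lemma move_quadratic:
  fixes g :: "('a::{field,finite}, 'n::finite) flag \<Rightarrow> int"
  assumes i: "Suc i < CARD('n)"
  shows "move i (move i g) F = (int CARD('a) - 1) * move i g F + int CARD('a) * g F"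
proof (cases "F \<in> flags")
  case F: True
  have "move i (move i g) F =
      (\<Sum>X\<in>panel i F - {F (Suc i)}. \<Sum>Y\<in>panel i F - {X}. g (F(Suc i := Y)))"
    using F by (simp add: move_def flag_upd_panel)
  also have "\<dots> = (int CARD('a) - 1) * (\<Sum>X\<in>panel i F - {F (Suc i)}. g (F(Suc i := X)))
      + int CARD('a) * g (F(Suc i := F (Suc i)))"
    using F i by (intro sum_sum_Diff_singleton finite flag_in_panel card_panel)
  finally show ?thesis using F by (simp add: move_def)
next
  case False
  then show ?thesis by (simp add: move_def algebra_simps)
qed

lemma move_commute:
  fixes g :: "('a::{field,finite}, 'n::finite) flag \<Rightarrow> int"
  assumes ij: "Suc i < j"
  shows "move i (move j g) F = move j (move i g) F"
proof (cases "F \<in> flags")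
  case F: True
  have "move i (move j g) F = (\<Sum>X\<in>panel i F - {F (Suc i)}. \<Sum>Y\<in>panel j F - {F (Suc j)}.
      g (F(Suc i := X, Suc j := Y)))"
    using F ij by (simp add: move_def flag_upd_panel)
  also have "\<dots> = (\<Sum>Y\<in>panel j F - {F (Suc j)}. \<Sum>X\<in>panel i F - {F (Suc i)}.
      g (F(Suc j := Y, Suc i := X)))"
    using ij by (subst sum.swap) (simp add: fun_upd_twist)
  also have "\<dots> = move j (move i g) F"
    using F ij by (simp add: move_def flag_upd_panel)
  finally show ?thesis .
next
  case False
  then show ?thesis by (simp add: move_def)
qed

lemma move_braid:
  fixes g :: "('a::{field,finite}, 'n::finite) flag \<Rightarrow> int"
  assumes i: "Suc (Suc i) < CARD('n)"
  shows "move i (move (Suc i) (move i g)) F = move (Suc i) (move i (move (Suc i) g)) F"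
proof (cases "F \<in> flags")
  case F: True
  let ?A = "F i" and ?X = "F (Suc i)" and ?Y = "F (Suc (Suc i))" and ?B = "F (Suc (Suc (Suc i)))"
  have dims: "vec.dim ?A = i" "vec.dim ?X = i + 1" "vec.dim ?Y = i + 2" "vec.dim ?B = i + 3"
    and subspaces: "vec.subspace (F j)" for j
    using F i by (simp_all add: flags_def)
  have flag: "?X \<in> between ?A ?B (Suc i)" "?Y \<in> between ?X ?B (Suc (Suc i))"
    using dims subspaces flags_subset[OF F] by (simp_all add: between_def)
  have upd_in_flags: "F(Suc i := X) \<in> flags"
      "Y \<in> between X ?B (Suc (Suc i)) \<Longrightarrow> F(Suc i := X, Suc (Suc i) := Y) \<in> flags"
    if "X \<in> between ?A ?Y (Suc i)" for X Y
    using F that by (auto intro!: flag_upd_panel simp: panel_def)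
  have upd_in_flags': "F(Suc (Suc i) := Y) \<in> flags"
      "X \<in> between ?A Y (Suc i) \<Longrightarrow> F(Suc i := X, Suc (Suc i) := Y) \<in> flags"
    if "Y \<in> between ?X ?B (Suc (Suc i))" for X Y
    using F that flag_upd_panel[of "F(Suc (Suc i) := Y)" X i]
    by (auto intro!: flag_upd_panel simp: panel_def fun_upd_twist[of "Suc i"])
  have "move i (move (Suc i) (move i g)) F = (\<Sum>X\<in>between ?A ?Y (Suc i) - {?X}.
      \<Sum>Y\<in>between X ?B (Suc (Suc i)) - {?Y}. \<Sum>X'\<in>between ?A Y (Suc i) - {X}.
      g (F(Suc i := X', Suc (Suc i) := Y)))"
    using F upd_in_flags by (simp add: move_def panel_def fun_upd_twist[of "Suc i"])
  also have "\<dots> = (\<Sum>Y\<in>between ?X ?B (Suc (Suc i)) - {?Y}. \<Sum>X\<in>between ?A Y (Suc i) - {?X}.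
      \<Sum>Y'\<in>between X ?B (Suc (Suc i)) - {Y}. g (F(Suc i := X, Suc (Suc i) := Y')))"
    using dims subspaces flag by (intro sum_between_braid) simp_all
  also have "\<dots> = move (Suc i) (move i (move (Suc i) g)) F"
    using F upd_in_flags' by (simp add: move_def panel_def fun_upd_twist[of "Suc i"])
  finally show ?thesis .
next
  case False
  then show ?thesis by (simp add: move_def)
qed

definition supported_on ::
    "nat \<Rightarrow> ('a ^ 'n) set \<Rightarrow> (('a::{field,finite}, 'n::finite) flag \<Rightarrow> int) \<Rightarrow> bool" where
  "supported_on i X g \<longleftrightarrow> (\<forall>F\<in>flags. F (Suc i) \<noteq> X \<longrightarrow> g F = 0)"

definition vanishes_on ::
    "nat \<Rightarrow> ('a ^ 'n) set \<Rightarrow> (('a::{field,finite}, 'n::finite) flag \<Rightarrow> int) \<Rightarrow> bool" where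
  "vanishes_on i X g \<longleftrightarrow> (\<forall>F\<in>flags. F (Suc i) = X \<longrightarrow> g F = 0)"

lemma supported_on_foldr_move:
  "i \<notin> set w \<Longrightarrow> supported_on i X g \<Longrightarrow> supported_on i X (foldr move w g)"
  by (induction w) (auto simp: supported_on_def move_def flag_upd_panel intro!: sum.neutral)

lemma vanishes_on_foldr_move:
  "i \<notin> set w \<Longrightarrow> vanishes_on i X g \<Longrightarrow> vanishes_on i X (foldr move w g)"
  by (induction w) (auto simp: vanishes_on_def move_def flag_upd_panel intro!: sum.neutral)

lemma vanishes_on_move: "supported_on i X g \<Longrightarrow> vanishes_on i X (move i g)"
  by (auto simp: supported_on_def vanishes_on_def move_def flag_upd_panel intro!: sum.neutral)

text \<open>A gallery whose type contains the letter \<open>i\<close> exactly once replaces \<open>F (Suc i)\<close> for good, so it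
  cannot close up.\<close>
lemma foldr_move_diagonal:
  assumes F: "F \<in> flags" and once: "count_list w i = 1"
  shows "foldr move w (point_mass F) F = 0"
proof -
  have "i \<in> set w" using once count_notin[of i w] by fastforce
  then obtain u v where w: "w = u @ i # v" "i \<notin> set u"
    using split_list_first by metis
  with once have "i \<notin> set v" by (auto simp: count_list_0_iff)
  moreover have "supported_on i (F (Suc i)) (point_mass F)"
    by (auto simp: supported_on_def point_mass_def)
  ultimately have "vanishes_on i (F (Suc i)) (foldr move w (point_mass F))"
    using w by (simp add: supported_on_foldr_move vanishes_on_move vanishes_on_foldr_move)
  with F show ?thesis by (simp add: vanishes_on_def)
qed

section \<open>Steps of Coxeter type\<close>

definition successors_upto ::
    "nat \<Rightarrow> ('a::{field,finite}, 'n::finite) flag \<Rightarrow> ('a, 'n) flag set" where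
  "successors_upto k F =
     {G \<in> flags. (\<forall>i<k. G (Suc i) \<subseteq> F (Suc (Suc i)) \<and> G (Suc i) \<noteq> F (Suc i))
       \<and> (\<forall>i\<ge>k. G (Suc i) = F (Suc i))}"

lemma successors_upto_subset:
  assumes F: "F \<in> flags" and G: "G \<in> successors_upto (Suc k) F"
  shows "G k \<subseteq> F (Suc k)"
proof (cases k)
  case 0
  then show ?thesis
    using F G flags_subset[OF F, of 0 "Suc 0"] by (simp add: successors_upto_def flags_0)
next
  case (Suc j)
  then show ?thesis using G by (simp add: successors_upto_def)
qed

lemma bij_betw_successors_upto_Suc:
  fixes F :: "('a::{field,finite}, 'n::finite) flag"
  assumes F: "F \<in> flags" and k: "Suc k < CARD('n)"
  shows "bij_betw (\<lambda>(G, X). G(Suc k := X))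
    (SIGMA G:successors_upto k F. panel k G - {G (Suc k)}) (successors_upto (Suc k) F)"
    (is "bij_betw ?upd ?pairs _")
proof (rule bij_betw_byWitness[where f' = "\<lambda>H. (H(Suc k := F (Suc k)), H (Suc k))"])
  show "\<forall>p\<in>?pairs. ((?upd p)(Suc k := F (Suc k)), ?upd p (Suc k)) = p"
    by (auto simp: successors_upto_def fun_upd_idem)
  show "?upd ` ?pairs \<subseteq> successors_upto (Suc k) F"
  proof (rule image_subsetI)
    fix p assume "p \<in> ?pairs"
    then obtain G X where p: "p = (G, X)" and G: "G \<in> successors_upto k F"
      and X: "X \<in> panel k G" "X \<noteq> G (Suc k)"
      by auto
    have "G(Suc k := X) \<in> flags"
      using G X by (intro flag_upd_panel) (simp_all add: successors_upto_def)
    then show "?upd p \<in> successors_upto (Suc k) F"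
      using G X by (auto simp: p successors_upto_def panel_def between_def less_Suc_eq)
  qed
  show "(\<lambda>H. (H(Suc k := F (Suc k)), H (Suc k))) ` successors_upto (Suc k) F \<subseteq> ?pairs"
  proof (rule image_subsetI)
    fix H assume H: "H \<in> successors_upto (Suc k) F"
    then have H_flag: "H \<in> flags" by (simp add: successors_upto_def)
    have "F (Suc k) \<in> panel k H"
      using F H k flags_subset[OF F, of "Suc k" "Suc (Suc k)"] successors_upto_subset[OF F H]
      by (auto simp: panel_def between_def flags_def successors_upto_def)
    then have "H(Suc k := F (Suc k)) \<in> flags"
      by (rule flag_upd_panel[OF H_flag])
    moreover have "H (Suc k) \<in> panel k H"
      using H_flag k by (rule flag_in_panel)
    ultimately show "(H(Suc k := F (Suc k)), H (Suc k)) \<in> ?pairs"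
      using H by (auto simp: successors_upto_def)
  qed
qed (auto simp: successors_upto_def)

lemma finite_successors_upto: "finite (successors_upto k F)"
  by (rule finite_subset[OF _ finite_flags]) (auto simp: successors_upto_def)

lemma successors_upto_0: "F \<in> flags \<Longrightarrow> successors_upto 0 F = {F}"
proof (intro equalityI subsetI)
  fix G assume F: "F \<in> flags" and G: "G \<in> successors_upto 0 F"
  have "G i = F i" for i
    using F G by (cases i) (auto simp: successors_upto_def flags_0)
  then show "G \<in> {F}" by auto
qed (auto simp: successors_upto_def)

lemma foldr_move_eq_sum_successors_upto:
  fixes F :: "('a::{field,finite}, 'n::finite) flag"
  assumes F: "F \<in> flags" and k: "k < CARD('n)"
  shows "foldr move [0..<k] g F = (\<Sum>G\<in>successors_upto k F. g G)"
  using k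
proof (induction k arbitrary: g)
  case 0
  then show ?case using F by (simp add: successors_upto_0)
next
  case (Suc k)
  have "foldr move [0..<Suc k] g F = (\<Sum>G\<in>successors_upto k F. move k g G)"
    using Suc by simp
  also have "\<dots> = (\<Sum>G\<in>successors_upto k F. \<Sum>X\<in>panel k G - {G (Suc k)}. g (G(Suc k := X)))"
    by (intro sum.cong refl) (simp add: move_def successors_upto_def)
  also have "\<dots> = (\<Sum>(G, X)\<in>(SIGMA G:successors_upto k F. panel k G - {G (Suc k)}).
      g (G(Suc k := X)))"
    by (simp add: sum.Sigma finite_successors_upto)
  also have "\<dots> = (\<Sum>H\<in>successors_upto (Suc k) F. g H)"
    using sum.reindex_bij_betw[OF bij_betw_successors_upto_Suc[OF F Suc.prems], of g]
    by (simp add: case_prod_unfold)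
  finally show ?case .
qed

definition successors :: "('a::{field,finite}, 'n::finite) flag \<Rightarrow> ('a, 'n) flag set" where
  "successors F = successors_upto (CARD('n) - 1) F"

lemma foldr_move_eq_sum_successors:
  fixes F :: "('a::{field,finite}, 'n::finite) flag"
  assumes "F \<in> flags"
  shows "foldr move [0..<CARD('n) - 1] g F = (\<Sum>G\<in>successors F. g G)"
  unfolding successors_def using assms by (intro foldr_move_eq_sum_successors_upto) auto

lemma successors_subset_flags: "successors F \<subseteq> flags"
  by (auto simp: successors_def successors_upto_def)

lemma span_Un_successor:
  fixes F G :: "('a::{field,finite}, 'n::finite) flag"
  assumes F: "F \<in> flags" and G: "G \<in> successors F" and k: "0 < k" "k < CARD('n)"
  shows "vec.span (F k \<union> G k) = F (Suc k)"
proof -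
  have "G \<in> flags" using G successors_subset_flags by blast
  then have dims: "vec.dim (F (Suc k)) = Suc k" "vec.dim (F k) = k" "vec.dim (G k) = k"
    and subspaces: "vec.subspace (F j)" "vec.subspace (G j)" for j
    using F k by (simp_all add: flags_def)
  obtain j where "k = Suc j" using k by (cases k) auto
  then have G_k: "G k \<subseteq> F (Suc k)" "G k \<noteq> F k"
    using G k by (simp_all add: successors_def successors_upto_def)
  have "vec.dim (F k \<inter> G k) < k"
    using dim_Int_less[of "F k" "G k"] dims subspaces G_k by simp
  then have "Suc k \<le> vec.dim (F k \<union> G k)"
    using dim_Un_Int[of "F k" "G k"] dims subspaces by simp
  then show ?thesis
    using dims subspaces G_k flags_subset[OF F, of k "Suc k"]
    by (intro vec.subspace_dim_equal vec.span_minimal) simp_all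
qed

section \<open>Cyclic tuples of points\<close>

lemma span_lift:
  assumes "p \<in> proj_points" "is_lift x p"
  shows "vec.span {x} = p"
proof (rule vec.subspace_dim_equal)
  show "vec.span {x} \<subseteq> p"
    using assms by (intro vec.span_minimal) (auto simp: proj_points_def is_lift_def)
qed (use assms in \<open>auto simp: proj_points_def is_lift_def\<close>)

lemma ex_lift:
  assumes "p \<in> proj_points"
  shows "\<exists>x. is_lift x p"
proof -
  have "vec.dim p \<noteq> 0" using assms by (simp add: proj_points_def)
  then have "\<not> p \<subseteq> {0}" by (metis vec.dim_eq_0)
  then show ?thesis unfolding is_lift_def by blast
qed

lemma span_lifts:
  assumes "list_all2 is_lift xs ps" "set ps \<subseteq> proj_points"
  shows "vec.span (set xs) = vec.span (\<Union>(set ps))"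
  using assms
proof (induction rule: list_all2_induct)
  case (Cons x xs p ps)
  have "vec.span (set (x # xs)) = vec.span (vec.span {x} \<union> vec.span (set xs))"
    by (simp add: span_Un_span)
  also have "\<dots> = vec.span (vec.span p \<union> vec.span (\<Union>(set ps)))"
    using Cons span_lift[of p x] by (simp, metis vec.span_span)
  finally show ?case by (simp add: span_Un_span)
qed simp

lemma distinct_independent_iff_dim:
  "distinct xs \<and> vec.independent (set xs) \<longleftrightarrow> vec.dim (set xs) = length xs"
proof
  assume "distinct xs \<and> vec.independent (set xs)"
  then show "vec.dim (set xs) = length xs"
    by (simp add: vec.dim_eq_card_independent distinct_card)
next
  assume dim: "vec.dim (set xs) = length xs"
  then have card: "card (set xs) = length xs"
    using vec.dim_le_card'[of "set xs"] card_length[of xs] by simp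
  moreover have "vec.independent (set xs)"
    using dim card by (intro vec.card_le_dim_spanning[of "set xs" "set xs"])
      (auto simp: vec.span_superset)
  ultimately show "distinct xs \<and> vec.independent (set xs)"
    by (simp add: card_distinct)
qed

lemma proj_independent_iff_dim:
  assumes ps: "set ps \<subseteq> proj_points"
  shows "proj_independent ps \<longleftrightarrow> vec.dim (\<Union>(set ps)) = length ps"
proof -
  have "distinct xs \<and> vec.independent (set xs) \<longleftrightarrow> vec.dim (\<Union>(set ps)) = length ps"
    if "list_all2 is_lift xs ps" for xs
    using vec.span_eq_dim[OF span_lifts[OF that ps]] list_all2_lengthD[OF that]
    by (simp add: distinct_independent_iff_dim)
  moreover have "is_lift (SOME x. is_lift x p) p" if "p \<in> set ps" for p
    using that ps someI_ex[OF ex_lift[of p]] by blast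
  then have "list_all2 is_lift (map (\<lambda>p. SOME x. is_lift x p) ps) ps"
    by (simp add: list.rel_map list.rel_refl_strong)
  ultimately show ?thesis
    unfolding proj_independent_def by blast
qed

definition cyclic_bases :: "nat \<Rightarrow> ('a::field ^ 'n::finite) set list set" where
  "cyclic_bases n = {v. length v = n \<and> set v \<subseteq> proj_points \<and>
     (\<forall>i. vec.dim (\<Union>j<CARD('n). v ! ((i + j) mod n)) = CARD('n))}"

lemma C4_eq_cyclic_bases:
  assumes n: "n > 0"
  shows "C4 n = (cyclic_bases n :: ('a::field ^ 4) set list set)"
proof -
  let ?window =
    "\<lambda>v i. [v ! (i mod n), v ! ((i + 1) mod n), v ! ((i + 2) mod n), v ! ((i + 3) mod n)]"
  have window: "proj_independent (?window v i)
      \<longleftrightarrow> vec.dim (\<Union>j<CARD(4). v ! ((i + j) mod n)) = CARD(4)"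
    if "length v = n" "set v \<subseteq> proj_points" for v :: "('a ^ 4) set list" and i
  proof -
    have "v ! (j mod n) \<in> proj_points" for j
      using that n by (intro subsetD[OF that(2)] nth_mem) simp
    then have "proj_independent (?window v i) \<longleftrightarrow> vec.dim (\<Union>(set (?window v i))) = 4"
      using proj_independent_iff_dim[of "?window v i"] by (simp add: numeral_eq_Suc)
    also have "{..<CARD(4)} = {0, 1, 2, 3}" by auto
    then have "\<Union>(set (?window v i)) = (\<Union>j<CARD(4). v ! ((i + j) mod n))"
      by (simp add: Un_ac)
    finally show ?thesis by simp
  qed
  have cyclic: "(\<forall>i<n. proj_independent
        [v ! i, v ! ((i + 1) mod n), v ! ((i + 2) mod n), v ! ((i + 3) mod n)])
      \<longleftrightarrow> (\<forall>i. proj_independent (?window v i))" for v :: "('a ^ 4) set list"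
  proof -
    have "?window v (i mod n) = ?window v i" for i by (simp add: mod_simps)
    then show ?thesis using n by (metis mod_less mod_less_divisor)
  qed
  show ?thesis
    unfolding C4_def cyclic_bases_def cyclic using window by blast
qed

definition span_flag :: "(nat \<Rightarrow> ('a::field ^ 'n::finite) set) \<Rightarrow> nat \<Rightarrow> ('a, 'n) flag" where
  "span_flag p i k = vec.span (\<Union>j<k. p (i + j))"

lemma span_flag_mono: "k \<le> l \<Longrightarrow> span_flag p i k \<subseteq> span_flag p i l"
  unfolding span_flag_def by (intro vec.span_mono UN_mono) auto

lemma span_flag_1:
  assumes "vec.subspace (p i)"
  shows "span_flag p i 1 = p i"
proof -
  have "span_flag p i 1 = vec.span (p i)"
    by (simp add: span_flag_def lessThan_Suc)
  with assms show ?thesis by (simp only: vec.span_eq_iff)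
qed

lemma dim_span_flag_add_le:
  assumes dim_le: "\<And>j. vec.dim (p j) \<le> 1"
  shows "vec.dim (span_flag p i (k + d)) \<le> vec.dim (span_flag p i k) + d"
proof (induction d)
  case (Suc d)
  have "vec.dim (span_flag p i (k + Suc d))
      \<le> vec.dim (span_flag p i (k + d)) + vec.dim (p (i + (k + d)))"
    using dim_Un_le[of "\<Union>j<k + d. p (i + j)" "p (i + (k + d))"]
    by (simp add: span_flag_def lessThan_Suc Un_commute)
  with Suc dim_le[of "i + (k + d)"] show ?case by simp
qed simp

lemma dim_span_flag:
  fixes p :: "nat \<Rightarrow> ('a::field ^ 'n::finite) set"
  assumes dim_le: "\<And>j. vec.dim (p j) \<le> 1" and full: "vec.dim (span_flag p i CARD('n)) = CARD('n)"
  shows "vec.dim (span_flag p i k) = min k CARD('n)"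
proof (cases "k \<le> CARD('n)")
  case True
  note add_le = dim_span_flag_add_le[where p = p and i = i, OF dim_le]
  have "vec.dim (span_flag p i k) \<le> k"
    using add_le[of 0 k] by (simp add: span_flag_def)
  moreover have "CARD('n) \<le> vec.dim (span_flag p i k) + (CARD('n) - k)"
    using add_le[of k "CARD('n) - k"] True full by simp
  ultimately show ?thesis using True by simp
next
  case False
  then have "vec.dim (span_flag p i CARD('n)) \<le> vec.dim (span_flag p i k)"
    by (intro vec.dim_subset span_flag_mono) simp
  then show ?thesis
    using False full dim_subset_UNIV_cart_gen[of "span_flag p i k"] by simp
qed

lemma span_flag_Suc:
  assumes "k > 0"
  shows "span_flag p i (Suc k) = vec.span (span_flag p i k \<union> span_flag p (Suc i) k)"
proof -
  have "{..<Suc k} = {..<k} \<union> Suc ` {..<k}"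
    using assms by (auto simp: image_Suc_lessThan)
  then have "(\<Union>j<Suc k. p (i + j)) = (\<Union>j<k. p (i + j)) \<union> (\<Union>j<k. p (Suc i + j))"
    by (simp add: UN_Un image_image)
  then show ?thesis by (simp add: span_flag_def span_Un_span)
qed

lemma span_flag_in_flags:
  fixes p :: "nat \<Rightarrow> ('a::{field,finite} ^ 'n::finite) set"
  assumes "\<And>j. vec.dim (p j) \<le> 1" and "vec.dim (span_flag p i CARD('n)) = CARD('n)"
  shows "span_flag p i \<in> flags"
  using dim_span_flag[OF assms]
  by (simp add: flags_def mono_def span_flag_mono) (simp add: span_flag_def)

lemma span_flag_successor:
  fixes p :: "nat \<Rightarrow> ('a::{field,finite} ^ 'n::finite) set"
  assumes dim_le: "\<And>j. vec.dim (p j) \<le> 1"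
    and full: "\<And>i. vec.dim (span_flag p i CARD('n)) = CARD('n)"
  shows "span_flag p (Suc i) \<in> successors (span_flag p i)"
proof -
  have flag: "span_flag p i \<in> flags" for i
    by (rule span_flag_in_flags[OF dim_le full])
  have "span_flag p (Suc i) (Suc k) \<subseteq> span_flag p i (Suc (Suc k))" for k
    using vec.span_superset[of "span_flag p i (Suc k) \<union> span_flag p (Suc i) (Suc k)"]
    by (simp add: span_flag_Suc[of "Suc k"])
  moreover have "span_flag p (Suc i) (Suc k) \<noteq> span_flag p i (Suc k)" if "k < CARD('n) - 1" for k
  proof
    assume "span_flag p (Suc i) (Suc k) = span_flag p i (Suc k)"
    then have "vec.dim (span_flag p i (Suc (Suc k))) = vec.dim (span_flag p i (Suc k))"
      by (simp add: span_flag_Suc[of "Suc k"])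
    with that show False by (simp add: dim_span_flag[OF dim_le full])
  qed
  moreover have "span_flag p (Suc i) (Suc k) = span_flag p i (Suc k)" if "k \<ge> CARD('n) - 1" for k
    using that by (simp add: flags_UNIV[OF flag])
  ultimately show ?thesis
    using flag by (simp add: successors_def successors_upto_def)
qed

lemma flag_walk_eq_span_flag:
  fixes f :: "nat \<Rightarrow> ('a::{field,finite}, 'n::finite) flag"
  assumes flag: "\<And>i. f i \<in> flags" and step: "\<And>i. f (Suc i) \<in> successors (f i)"
  shows "f i = span_flag (\<lambda>j. f j 1) i"
proof
  let ?p = "\<lambda>j. f j 1"
  have upto: "f i k = span_flag ?p i k" if "k \<le> CARD('n)" for i k
    using that
  proof (induction k arbitrary: i)
    case 0
    then show ?case using flags_0[OF flag] by (simp add: span_flag_def)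
  next
    case (Suc k)
    show ?case
    proof (cases "k = 0")
      case True
      have "vec.subspace (f i 1)" using flag[of i] by (simp add: flags_def)
      with True show ?thesis using span_flag_1[of ?p i] by simp
    next
      case False
      then have "f i (Suc k) = vec.span (f i k \<union> f (Suc i) k)"
        using span_Un_successor[OF flag step] Suc.prems by simp
      with False Suc show ?thesis by (simp add: span_flag_Suc)
    qed
  qed
  show "f i k = span_flag ?p i k" for k
  proof (cases "k \<le> CARD('n)")
    case False
    then have "UNIV \<subseteq> span_flag ?p i k"
      using upto[of "CARD('n)" i] span_flag_mono[of "CARD('n)" k ?p i] flags_UNIV[OF flag]
      by simp
    with False show ?thesis using flags_UNIV[OF flag, of k i] by auto
  qed (rule upto)
qed

lemma closed_walk_nth:
  fixes w :: "('a::{field,finite}, 'n::finite) flag list"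
  assumes w: "w \<in> closed_walks flags successors n" and n: "n > 0"
  shows "w ! (i mod n) \<in> flags"
    and "w ! (i mod n) = span_flag (\<lambda>j. map (\<lambda>F. F 1) w ! (j mod n)) i"
proof -
  have len: "length w = n"
    using w by (simp add: closed_walks_def)
  have flag: "w ! (j mod n) \<in> flags" for j
    using w n len by (intro subsetD[of "set w" flags] nth_mem) (simp_all add: closed_walks_def)
  then show "w ! (i mod n) \<in> flags" .
  have step: "w ! (Suc j mod n) \<in> successors (w ! (j mod n))" for j
    using w by (simp add: closed_walks_def)
  show "w ! (i mod n) = span_flag (\<lambda>j. map (\<lambda>F. F 1) w ! (j mod n)) i"
    using flag_walk_eq_span_flag[where f = "\<lambda>j. w ! (j mod n)" and i = i, OF flag step] n len
    by simp
qed

lemma points_of_closed_walk_in_cyclic_bases: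
  fixes w :: "('a::{field,finite}, 'n::finite) flag list"
  assumes w: "w \<in> closed_walks flags successors n" and n: "n > 0"
  shows "map (\<lambda>F. F 1) w \<in> cyclic_bases n"
proof -
  have "length w = n" "set w \<subseteq> flags"
    using w by (auto simp: closed_walks_def)
  moreover from this have "set (map (\<lambda>F. F 1) w) \<subseteq> proj_points"
    by (auto simp: flags_def proj_points_def)
  moreover have "vec.dim (\<Union>j<CARD('n). map (\<lambda>F. F 1) w ! ((i + j) mod n)) = CARD('n)" for i
    using closed_walk_nth[OF w n, of i] by (simp add: flags_def span_flag_def)
  ultimately show ?thesis by (simp add: cyclic_bases_def)
qed

lemma cyclic_bases_nth: "v \<in> cyclic_bases n \<Longrightarrow> n > 0 \<Longrightarrow> v ! (i mod n) \<in> proj_points"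
  by (intro subsetD[of "set v" proj_points] nth_mem) (simp_all add: cyclic_bases_def)

lemma span_flags_in_closed_walks:
  fixes v :: "('a::{field,finite} ^ 'n::finite) set list"
  assumes v: "v \<in> cyclic_bases n" and n: "n > 0"
  shows "map (span_flag (\<lambda>j. v ! (j mod n))) [0..<n] \<in> closed_walks flags successors n"
proof -
  let ?p = "\<lambda>j. v ! (j mod n)"
  have dim_le: "vec.dim (?p j) \<le> 1" for j
    using cyclic_bases_nth[OF v n, of j] by (simp add: proj_points_def)
  have full: "vec.dim (span_flag ?p i CARD('n)) = CARD('n)" for i
    using v by (simp add: cyclic_bases_def span_flag_def)
  have periodic: "span_flag ?p (i mod n) = span_flag ?p i" for i
    by (simp add: span_flag_def fun_eq_iff mod_simps)
  have "span_flag ?p i \<in> flags" "span_flag ?p (Suc i) \<in> successors (span_flag ?p i)" for i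
    by (rule span_flag_in_flags span_flag_successor dim_le full)+
  then show ?thesis
    using n by (auto simp: closed_walks_def periodic)
qed

lemma bij_betw_closed_walks_cyclic_bases:
  assumes n: "n > 0"
  shows "bij_betw (map (\<lambda>F. F 1)) (closed_walks flags successors n)
    (cyclic_bases n :: ('a::{field,finite} ^ 'n::finite) set list set)"
proof (rule bij_betw_byWitness[where f' = "\<lambda>v. map (span_flag (\<lambda>j. v ! (j mod n))) [0..<n]"])
  show "\<forall>w\<in>closed_walks flags successors n.
      map (span_flag (\<lambda>j. map (\<lambda>F. F 1) w ! (j mod n))) [0..<n] = (w :: ('a, 'n) flag list)"
  proof
    fix w :: "('a, 'n) flag list" assume w: "w \<in> closed_walks flags successors n"
    then show "map (span_flag (\<lambda>j. map (\<lambda>F. F 1) w ! (j mod n))) [0..<n] = w"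
      using closed_walk_nth(2)[OF w n] by (auto simp: closed_walks_def intro!: nth_equalityI)
        (metis mod_less)
  qed
  show "\<forall>v\<in>cyclic_bases n. map (\<lambda>F. F 1) (map (span_flag (\<lambda>j. v ! (j mod n))) [0..<n])
      = (v :: ('a ^ 'n) set list)"
  proof
    fix v :: "('a ^ 'n) set list" assume v: "v \<in> cyclic_bases n"
    have "span_flag (\<lambda>j. v ! (j mod n)) i 1 = v ! (i mod n)" for i
      using cyclic_bases_nth[OF v n, of i] by (intro span_flag_1) (simp add: proj_points_def)
    then show "map (\<lambda>F. F 1) (map (span_flag (\<lambda>j. v ! (j mod n))) [0..<n]) = v"
      using v by (auto simp: cyclic_bases_def intro!: nth_equalityI)
  qed
qed (rule image_subsetI,
    erule points_of_closed_walk_in_cyclic_bases[OF _ n] span_flags_in_closed_walks[OF _ n])+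

lemma card_cyclic_bases:
  assumes "n > 0"
  shows "int (card (cyclic_bases n :: ('a::{field,finite} ^ 'n::finite) set list set))
    = trace_on (flags :: ('a, 'n) flag set) (foldr move [0..<CARD('n) - 1] ^^ n)"
proof -
  have "card (cyclic_bases n :: ('a ^ 'n) set list set)
      = card (closed_walks (flags :: ('a, 'n) flag set) successors n)"
    by (rule bij_betw_same_card[OF bij_betw_closed_walks_cyclic_bases[OF assms], symmetric])
  also have "int \<dots> = trace_on (flags :: ('a, 'n) flag set) (foldr move [0..<CARD('n) - 1] ^^ n)"
    using assms by (intro card_closed_walks finite_flags successors_subset_flags
        foldr_move_eq_sum_successors)
  finally show ?thesis .
qed

section \<open>Linear recurrences\<close>

definition poly_shift :: "'a::comm_ring_1 poly \<Rightarrow> (nat \<Rightarrow> 'a) \<Rightarrow> nat \<Rightarrow> 'a" where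
  "poly_shift p a n = (\<Sum>k\<le>degree p. coeff p k * a (n + k))"

lemma poly_shift_upto:
  assumes "degree p \<le> d"
  shows "poly_shift p a n = (\<Sum>k\<le>d. coeff p k * a (n + k))"
  unfolding poly_shift_def using assms
  by (intro sum.mono_neutral_left) (auto simp: coeff_eq_0)

lemma poly_shift_0 [simp]: "poly_shift 0 a n = 0"
  by (simp add: poly_shift_def)

lemma poly_shift_pCons [simp]: "poly_shift (pCons c p) a n = c * a n + poly_shift p a (Suc n)"
proof -
  have "poly_shift (pCons c p) a n = (\<Sum>k\<le>Suc (degree p). coeff (pCons c p) k * a (n + k))"
    by (rule poly_shift_upto) (rule degree_pCons_le)
  also have "\<dots> = c * a n + poly_shift p a (Suc n)"
    by (simp add: sum.atMost_Suc_shift poly_shift_def del: sum.atMost_Suc)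
  finally show ?thesis .
qed

lemma poly_shift_add: "poly_shift (p + r) a n = poly_shift p a n + poly_shift r a n"
  using degree_add_le_max[of p r]
  by (simp add: poly_shift_upto[where d = "max (degree p) (degree r)"] distrib_right sum.distrib)

lemma poly_shift_smult: "poly_shift (smult c p) a n = c * poly_shift p a n"
  using degree_smult_le[of c p]
  by (simp add: poly_shift_upto[where d = "degree p"] sum_distrib_left mult.assoc)

lemma poly_shift_mult: "poly_shift (p * r) a n = poly_shift p (poly_shift r a) n"
  by (induction p arbitrary: n) (simp_all add: poly_shift_add poly_shift_smult)

lemma poly_shift_monom: "poly_shift (monom c k) a n = c * a (n + k)"
  by (induction k arbitrary: n) (simp_all add: monom_0 monom_Suc)

definition annihilates :: "'a::comm_ring_1 poly \<Rightarrow> (nat \<Rightarrow> 'a) \<Rightarrow> bool" where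
  "annihilates p a \<longleftrightarrow> (\<forall>n. poly_shift p a n = 0)"

lemma annihilates_dvd:
  assumes "annihilates p a" "p dvd r"
  shows "annihilates r a"
proof -
  obtain s where "r = s * p" using \<open>p dvd r\<close> by (auto simp: dvd_def mult.commute)
  with assms show ?thesis
    by (simp add: annihilates_def poly_shift_mult) (simp add: poly_shift_def)
qed

lemma annihilates_add:
  "annihilates p a \<Longrightarrow> annihilates p b \<Longrightarrow> annihilates p (\<lambda>n. a n + b n)"
  by (simp add: annihilates_def poly_shift_def distrib_left sum.distrib)

lemma annihilates_cmult:
  "annihilates p a \<Longrightarrow> annihilates p (\<lambda>n. c * a n)"
  by (simp add: annihilates_def poly_shift_def mult.left_commute[of _ c] flip: sum_distrib_left)

lemma annihilates_sum:
  "(\<And>x. x \<in> A \<Longrightarrow> annihilates p (a x)) \<Longrightarrow> annihilates p (\<lambda>n. \<Sum>x\<in>A. a x n)"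
  by (simp add: annihilates_def poly_shift_def sum_distrib_left sum.swap[of _ A])

lemma annihilates_unique:
  assumes a: "annihilates p a" and b: "annihilates p b" and monic: "lead_coeff p = 1"
    and init: "\<And>k. k < degree p \<Longrightarrow> a k = b k"
  shows "a n = b n"
proof (induction n rule: less_induct)
  case (less n)
  show ?case
  proof (cases "n < degree p")
    case False
    then obtain l where l: "n = l + degree p" by (metis add.commute le_Suc_ex not_less)
    have "(\<Sum>k<degree p. coeff p k * a (l + k)) = (\<Sum>k<degree p. coeff p k * b (l + k))"
      using less l by (intro sum.cong) auto
    moreover have "(\<Sum>k<degree p. coeff p k * c (l + k)) + c n = 0" if "annihilates p c" for c
      using that monic l by (simp add: annihilates_def poly_shift_def flip: lessThan_Suc_atMost)
    ultimately show ?thesis using a b by (metis add_left_cancel)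
  qed (rule init)
qed

text \<open>The roots are the products of \<open>x\<close> with the fourth roots of unity other than 1.\<close>
definition geometric4 :: "'a::comm_ring_1 \<Rightarrow> 'a poly" where
  "geometric4 x = [:x ^ 3, x ^ 2, x, 1:]"

lemma annihilates_power: "annihilates [:- x, 1:] (\<lambda>n. x ^ n)"
  by (simp add: annihilates_def)

lemma annihilates_geometric4:
  "annihilates (geometric4 x) (\<lambda>n. (if 4 dvd n then 3 else -1) * x ^ n)"
proof -
  have "poly_shift (geometric4 x) (\<lambda>n. (if 4 dvd n then 3 else -1) * x ^ n) n = 0" for n
  proof -
    consider "n mod 4 = 0" | "n mod 4 = 1" | "n mod 4 = 2" | "n mod 4 = 3" by linarith
    then show ?thesis
      by cases (simp_all add: geometric4_def dvd_eq_mod_eq_0 mod_Suc algebra_simps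
          power2_eq_square power3_eq_cube)
  qed
  then show ?thesis by (simp add: annihilates_def)
qed

section \<open>The Hecke algebra of \<open>S\<^sub>4\<close>\<close>

locale hecke_A =
  fixes r :: nat and q :: int and T :: "nat \<Rightarrow> ('f \<Rightarrow> int) \<Rightarrow> 'f \<Rightarrow> int"
  assumes T_add: "T i (\<lambda>F. g F + h F) = (\<lambda>F. T i g F + T i h F)"
    and T_scale: "T i (\<lambda>F. a * g F) = (\<lambda>F. a * T i g F)"
    and quadratic: "i < r \<Longrightarrow> T i (T i g) = (\<lambda>F. (q - 1) * T i g F + q * g F)"
    and braid: "Suc i < r \<Longrightarrow> T i (T (Suc i) (T i g)) = T (Suc i) (T i (T (Suc i) g))"
    and commute: "j < r \<Longrightarrow> Suc i < j \<Longrightarrow> T i (T j g) = T j (T i g)"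
begin

lemma T_sum:
  "finite A \<Longrightarrow> T i (\<lambda>F. \<Sum>k\<in>A. c k * h k F) = (\<lambda>F. \<Sum>k\<in>A. c k * T i (h k) F)"
proof (induction A rule: finite_induct)
  case empty
  then show ?case using T_scale[of i 0 "\<lambda>_. 0"] by simp
qed (simp add: T_add T_scale)

lemma foldr_T_sum:
  "finite A \<Longrightarrow>
    foldr T w (\<lambda>F. \<Sum>k\<in>A. c k * h k F) = (\<lambda>F. \<Sum>k\<in>A. c k * foldr T w (h k) F)"
  by (induction w) (simp_all add: T_sum)

end

definition normal_words :: "nat list list" where
  "normal_words =
     [u @ v @ w. w \<leftarrow> [[], [2], [2, 1], [2, 1, 0]], v \<leftarrow> [[], [1], [1, 0]], u \<leftarrow> [[], [0]]]"

text \<open>The index in \<open>normal_words\<close> of the normal form of \<open>s\<^sub>i w\<close>, where \<open>w\<close> is the word with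
  index \<open>k\<close>; it exceeds \<open>k\<close> if and only if \<open>s\<^sub>i w\<close> is longer than \<open>w\<close>.\<close>
definition left_mult_index :: "nat \<Rightarrow> nat list" where
  "left_mult_index i =
    [[1, 0, 3, 2, 5, 4, 7, 6, 9, 8, 11, 10, 13, 12, 15, 14, 17, 16, 19, 18, 21, 20, 23, 22],
     [2, 4, 0, 5, 1, 3, 8, 10, 6, 11, 7, 9, 14, 16, 12, 17, 13, 15, 20, 22, 18, 23, 19, 21],
     [6, 7, 12, 13, 18, 19, 0, 1, 14, 15, 20, 21, 2, 3, 8, 9, 22, 23, 4, 5, 10, 11, 16, 17]] ! i"

text \<open>The list \<open>c\<close> holds the coordinates of an element of the Hecke algebra in the basis indexed by
  \<open>normal_words\<close>, as polynomials in \<open>q\<close>.\<close>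
definition left_mult :: "nat \<Rightarrow> int poly list \<Rightarrow> int poly list" where
  "left_mult i c = map (\<lambda>(k, l). if k < l then [:0, 1:] * c ! l else c ! l + [:-1, 1:] * c ! k)
     (List.enumerate 0 (left_mult_index i))"

lemma length_normal_words: "length normal_words = 24"
  by (simp add: normal_words_def)

lemma normal_words_0: "normal_words ! 0 = []"
  by (simp add: normal_words_def)

lemma normal_words_letter_once:
  "0 < k \<Longrightarrow> k < 24 \<Longrightarrow> \<exists>i. count_list (normal_words ! k) i = 1"
proof -
  have "\<forall>w\<in>set (tl normal_words). \<exists>i\<in>{0,1,2}. count_list w i = 1"
    by (simp add: normal_words_def)
  moreover assume "0 < k" "k < 24"
  then have "normal_words ! k \<in> set (tl normal_words)"
    using length_normal_words nth_tl[of "k - 1" normal_words]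
      nth_mem[of "k - 1" "tl normal_words"] by simp
  ultimately show ?thesis by blast
qed

lemma length_left_mult_index: "i < 3 \<Longrightarrow> length (left_mult_index i) = 24"
  by (auto simp: left_mult_index_def numeral_3_eq_3 less_Suc_eq)

lemma
  assumes "i < 3" "k < 24"
  shows left_mult_index_less: "left_mult_index i ! k < 24"
    and left_mult_index_involutive: "left_mult_index i ! (left_mult_index i ! k) = k"
    and left_mult_index_neq: "left_mult_index i ! k \<noteq> k"
proof -
  have "\<forall>i\<in>{..<3}. \<forall>k\<in>{..<24}. left_mult_index i ! k < 24 \<and>
      left_mult_index i ! (left_mult_index i ! k) = k \<and> left_mult_index i ! k \<noteq> k"
    by (simp add: left_mult_index_def lessThan_nat_numeral)
  with assms show "left_mult_index i ! k < 24" "left_mult_index i ! (left_mult_index i ! k) = k"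
    "left_mult_index i ! k \<noteq> k"
    by auto
qed

lemma nth_left_mult:
  assumes "i < 3" "k < 24"
  shows "left_mult i c ! k = (let l = left_mult_index i ! k in
    if k < l then [:0, 1:] * c ! l else c ! l + [:-1, 1:] * c ! k)"
  using assms by (simp add: left_mult_def length_left_mult_index nth_enumerate_eq)

locale hecke_A3 = hecke_A 3 q T for q :: int and T :: "nat \<Rightarrow> ('f \<Rightarrow> int) \<Rightarrow> 'f \<Rightarrow> int"
begin

lemma T_normal_word_ascent:
  assumes "i < 3" "k < 24" and "k < left_mult_index i ! k"
  shows "T i (foldr T (normal_words ! k) g) = foldr T (normal_words ! (left_mult_index i ! k)) g"
proof -
  have braids: "T (Suc 0) (T 0 (T (Suc 0) g)) = T 0 (T (Suc 0) (T 0 g))"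
      "T 2 (T (Suc 0) (T 2 g)) = T (Suc 0) (T 2 (T (Suc 0) g))"
    and comm: "T 2 (T 0 g) = T 0 (T 2 g)" for g
    using braid[of 0 g] braid[of 1 g] commute[of 2 0 g] by (simp_all add: numeral_2_eq_2)
  have "T 2 (T (Suc 0) (T 0 (T 2 g))) = T (Suc 0) (T 2 (T (Suc 0) (T 0 g)))" for g
    by (simp only: comm[symmetric] braids)
  then have "\<forall>i\<in>{..<3}. \<forall>k\<in>{..<24}. k < left_mult_index i ! k \<longrightarrow>
      T i (foldr T (normal_words ! k) g) = foldr T (normal_words ! (left_mult_index i ! k)) g"
    by (simp add: lessThan_nat_numeral left_mult_index_def normal_words_def braids comm)
  with assms show ?thesis by auto
qed

lemma T_normal_word:
  assumes i: "i < 3" and k: "k < 24"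
  shows "T i (foldr T (normal_words ! k) g) F = (let l = left_mult_index i ! k in
    if k < l then foldr T (normal_words ! l) g F
    else (q - 1) * foldr T (normal_words ! k) g F + q * foldr T (normal_words ! l) g F)"
proof (cases "k < left_mult_index i ! k")
  case True
  then show ?thesis using T_normal_word_ascent[OF i k True] by simp
next
  case False
  let ?l = "left_mult_index i ! k"
  have l: "?l < 24" "left_mult_index i ! ?l = k" "?l < k"
    using left_mult_index_less[OF i k] left_mult_index_involutive[OF i k]
      left_mult_index_neq[OF i k] False by auto
  have "foldr T (normal_words ! k) g = T i (foldr T (normal_words ! ?l) g)"
    using T_normal_word_ascent[OF i l(1)] l by simp
  then show ?thesis
    using False i quadratic[of i "foldr T (normal_words ! ?l) g"] by (simp add: Let_def)
qed

definition word_comb :: "int poly list \<Rightarrow> ('f \<Rightarrow> int) \<Rightarrow> 'f \<Rightarrow> int" where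
  "word_comb c g F = (\<Sum>k<24. poly (c ! k) q * foldr T (normal_words ! k) g F)"

lemma T_word_comb:
  assumes i: "i < 3"
  shows "T i (word_comb c g) = word_comb (left_mult i c) g"
proof
  fix F
  let ?s = "\<lambda>k. left_mult_index i ! k" and ?c = "\<lambda>k. poly (c ! k) q"
    and ?b = "\<lambda>k. foldr T (normal_words ! k) g F"
  have "T i (word_comb c g) F = (\<Sum>k<24. ?c k * T i (foldr T (normal_words ! k) g) F)"
    unfolding word_comb_def[abs_def] by (simp add: T_sum)
  also have "\<dots> = (\<Sum>k<24. (if k < ?s k then 0 else (q - 1) * ?c k * ?b k))
      + (\<Sum>k<24. (if k < ?s k then 1 else q) * ?c k * ?b (?s k))"
    unfolding sum.distrib[symmetric]
    by (intro sum.cong) (simp_all add: T_normal_word[OF i] Let_def algebra_simps)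
  also have "(\<Sum>k<24. (if k < ?s k then 1 else q) * ?c k * ?b (?s k)) =
      (\<Sum>k<24. (if ?s k < k then 1 else q) * ?c (?s k) * ?b k)"
    by (rule sum.reindex_bij_witness[where i = ?s and j = ?s])
      (simp_all add: left_mult_index_less[OF i] left_mult_index_involutive[OF i])
  also have "(\<Sum>k<24. (if k < ?s k then 0 else (q - 1) * ?c k * ?b k)) + \<dots>
      = word_comb (left_mult i c) g F"
    unfolding word_comb_def sum.distrib[symmetric]
  proof (intro sum.cong refl)
    fix k :: nat assume "k \<in> {..<24}"
    then show "(if k < ?s k then 0 else (q - 1) * ?c k * ?b k)
        + (if ?s k < k then 1 else q) * ?c (?s k) * ?b k = poly (left_mult i c ! k) q * ?b k"
      using left_mult_index_neq[OF i, of k]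
      by (cases k "?s k" rule: linorder_cases)
        (simp_all add: nth_left_mult[OF i] Let_def algebra_simps)
  qed
  finally show "T i (word_comb c g) F = word_comb (left_mult i c) g F" .
qed

abbreviation coxeter :: "('f \<Rightarrow> int) \<Rightarrow> 'f \<Rightarrow> int" where
  "coxeter \<equiv> foldr T [0..<3]"

end

text \<open>The roots of the factors are the eigenvalues of the Coxeter element in the five irreducible
  representations.\<close>
definition coxeter_poly :: "'a::comm_ring_1 \<Rightarrow> 'a poly" where
  "coxeter_poly q =
     [:- (q ^ 3), 1:] * geometric4 (q ^ 2) * [:- (q ^ 3), 0, 1:] * geometric4 (- q) * [:1, 1:]"

lemma degree_coxeter_poly: "degree (coxeter_poly (q :: 'a::idom)) = 10"
  by (simp add: coxeter_poly_def geometric4_def degree_mult_eq)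

lemma lead_coeff_coxeter_poly: "lead_coeff (coxeter_poly (q :: 'a::idom)) = 1"
  unfolding coxeter_poly_def geometric4_def lead_coeff_mult by simp

definition coxeter_mult :: "int poly list \<Rightarrow> int poly list" where
  "coxeter_mult c = left_mult 0 (left_mult 1 (left_mult 2 c))"

definition add_scalar :: "int poly \<Rightarrow> int poly list \<Rightarrow> int poly list" where
  "add_scalar a c = c[0 := a + c ! 0]"

definition coxeter_eval :: "int poly poly \<Rightarrow> int poly list" where
  "coxeter_eval p = foldr (\<lambda>a c. add_scalar a (coxeter_mult c)) (coeffs p) (replicate 24 0)"

context hecke_A3
begin

lemma coxeter_word_comb: "coxeter (word_comb c g) = word_comb (coxeter_mult c) g"
  by (simp add: T_word_comb coxeter_mult_def upt_rec flip: numeral_2_eq_2)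

lemma word_comb_add_scalar:
  assumes "length c = 24"
  shows "word_comb (add_scalar a c) g F = poly a q * g F + word_comb c g F"
proof -
  have "word_comb (add_scalar a c) g F = (\<Sum>k<24. (if k = 0 then poly a q * g F else 0)
      + poly (c ! k) q * foldr T (normal_words ! k) g F)"
    unfolding word_comb_def using assms
    by (intro sum.cong) (auto simp: add_scalar_def normal_words_0 algebra_simps)
  then show ?thesis by (simp add: sum.distrib word_comb_def)
qed

lemma word_comb_coxeter_eval:
  "word_comb (coxeter_eval p) g F
    = poly_shift (map_poly (\<lambda>a. poly a q) p) (\<lambda>k. (coxeter ^^ k) g F) 0"
proof (induction p arbitrary: F)
  case 0
  then show ?case by (simp add: word_comb_def coxeter_eval_def)
next
  case (pCons a p)
  let ?p = "map_poly (\<lambda>a. poly a q) p"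
  have "length (coxeter_mult c) = 24" for c
    by (simp add: coxeter_mult_def left_mult_def length_left_mult_index)
  then have "word_comb (coxeter_eval (pCons a p)) g F
      = poly a q * g F + word_comb (coxeter_mult (coxeter_eval p)) g F"
    using pCons.hyps by (auto simp: coxeter_eval_def word_comb_add_scalar cCons_def)
  also have "word_comb (coxeter_mult (coxeter_eval p)) g F
      = coxeter (word_comb (coxeter_eval p) g) F"
    by (simp only: coxeter_word_comb)
  also have "word_comb (coxeter_eval p) g = (\<lambda>F. \<Sum>k\<le>degree ?p. coeff ?p k * (coxeter ^^ k) g F)"
    using pCons.IH by (simp add: fun_eq_iff poly_shift_def)
  also have "coxeter \<dots> F = poly_shift ?p (\<lambda>k. (coxeter ^^ k) g F) 1"
    by (simp only: foldr_T_sum finite_atMost poly_shift_def) simp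
  finally show ?case
    by (simp add: map_poly_pCons)
qed

end

lemmas left_mult_explicit =
  left_mult_def[of 0, unfolded left_mult_index_def, simplified]
  left_mult_def[of "Suc 0", unfolded left_mult_index_def, simplified]
  left_mult_def[of 2, unfolded left_mult_index_def, simplified]

lemma coxeter_eval_0: "coxeter_eval 0 = replicate 24 0"
  by (simp add: coxeter_eval_def)

lemma add_scalar_0: "add_scalar 0 c = c"
  by (simp add: add_scalar_def)

lemma coxeter_mult_zero: "coxeter_mult (replicate 24 0) = replicate 24 0"
  by (simp add: coxeter_mult_def left_mult_explicit) (simp add: numeral_eq_Suc)

lemma coxeter_eval_pCons: "coxeter_eval (pCons a p) = add_scalar a (coxeter_mult (coxeter_eval p))"
  by (cases "a = 0 \<and> p = 0")
    (auto simp: coxeter_eval_def cCons_def coxeter_mult_zero add_scalar_0)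

lemma monom_numeral: "monom c (numeral n) = pCons 0 (monom c (pred_numeral n))"
  by (simp add: numeral_eq_Suc monom_Suc)

text \<open>Evaluates \<open>coxeter_eval\<close> on explicit polynomials. Unfolding \<open>coxeter_eval_def\<close> instead would
  make the simplifier expand \<open>coxeter_mult\<close> symbolically under the abstraction.\<close>
lemmas coxeter_eval_simps = coxeter_eval_0 coxeter_eval_pCons coxeter_mult_def left_mult_explicit
  add_scalar_def one_pCons monom_0 monom_Suc monom_numeral

lemma coxeter_eval_coxeter_poly: "coxeter_eval (coxeter_poly [:0, 1:]) = replicate 24 0"
  by (simp add: coxeter_poly_def geometric4_def power2_eq_square power3_eq_cube one_pCons)
    (simp add: coxeter_eval_simps, simp add: numeral_eq_Suc)

lemma map_poly_coxeter_poly: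
  "map_poly (\<lambda>a. poly a q) (coxeter_poly [:0, 1:]) = coxeter_poly (q :: int)"
  by (simp add: coxeter_poly_def geometric4_def power2_eq_square power3_eq_cube one_pCons
      map_poly_pCons) (intro conjI; algebra)

context hecke_A3
begin

lemma annihilates_coxeter: "annihilates (coxeter_poly q) (\<lambda>n. (coxeter ^^ n) g F)"
proof -
  have "poly_shift (coxeter_poly q) (\<lambda>k. (coxeter ^^ k) g F) n = 0" for n
  proof -
    have "poly_shift (coxeter_poly q) (\<lambda>k. (coxeter ^^ k) g F) n
        = poly_shift (coxeter_poly q) (\<lambda>k. (coxeter ^^ k) ((coxeter ^^ n) g) F) 0"
      by (simp add: poly_shift_def add.commute[of n] funpow_add)
    also have "\<dots> = word_comb (coxeter_eval (coxeter_poly [:0, 1:])) ((coxeter ^^ n) g) F"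
      by (simp add: word_comb_coxeter_eval map_poly_coxeter_poly)
    finally show ?thesis by (simp add: coxeter_eval_coxeter_poly word_comb_def)
  qed
  then show ?thesis by (simp add: annihilates_def)
qed

lemma coxeter_funpow: "(coxeter ^^ n) g F = word_comb (coxeter_eval (monom 1 n)) g F"
  by (simp add: word_comb_coxeter_eval map_poly_monom poly_shift_monom)

end

section \<open>The counting formula\<close>

definition closed_form :: "'a::comm_ring_1 \<Rightarrow> nat \<Rightarrow> 'a" where
  "closed_form q n = q ^ (3 * n)
     + (q ^ 3 + q ^ 2 + q) * ((if 4 dvd n then 3 else -1) * (q ^ 2) ^ n)
     + 2 * (q ^ 4 + q ^ 2) * (if even n then q ^ (3 * n div 2) else 0)
     + (q ^ 5 + q ^ 4 + q ^ 3) * ((if 4 dvd n then 3 else -1) * (- q) ^ n)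
     + q ^ 6 * (-1) ^ n"

lemma annihilates_half_power:
  "annihilates [:- (q ^ 3), 0, 1:] (\<lambda>n. if even n then q ^ (3 * n div 2) else 0)"
proof -
  have "3 * Suc (Suc n) div 2 = 3 * n div 2 + 3" for n :: nat by simp
  then show ?thesis by (simp add: annihilates_def power_add mult.commute)
qed

lemma annihilates_closed_form: "annihilates (coxeter_poly q) (closed_form q)"
proof -
  have "[:- (q ^ 3), 1:] dvd coxeter_poly q" "geometric4 (q ^ 2) dvd coxeter_poly q"
    "[:- (q ^ 3), 0, 1:] dvd coxeter_poly q" "geometric4 (- q) dvd coxeter_poly q"
    "[:- (- 1), 1:] dvd coxeter_poly q"
    by (simp_all only: coxeter_poly_def dvd_mult dvd_mult2 dvd_refl minus_minus)
  note factors = annihilates_dvd[OF annihilates_power this(1)]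
    annihilates_dvd[OF annihilates_geometric4 this(2)]
    annihilates_dvd[OF annihilates_half_power this(3)]
    annihilates_dvd[OF annihilates_geometric4 this(4)]
    annihilates_dvd[OF annihilates_power this(5)]
  show ?thesis
    unfolding closed_form_def power_mult by (intro annihilates_add annihilates_cmult factors)
qed

lemma hecke_A_move:
  "hecke_A (CARD('n) - 1) (int CARD('a))
     (move :: nat \<Rightarrow> (('a::{field,finite}, 'n::finite) flag \<Rightarrow> int) \<Rightarrow> ('a, 'n) flag \<Rightarrow> int)"
proof
  show "move i (\<lambda>F. g F + h F) = (\<lambda>F. move i g F + move i h F)"
    for i and g h :: "('a, 'n) flag \<Rightarrow> int"
    by (auto simp: move_def fun_eq_iff sum.distrib algebra_simps)
  show "move i (\<lambda>F. a * g F) = (\<lambda>F. a * move i g F)" for i a and g :: "('a, 'n) flag \<Rightarrow> int"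
    by (auto simp: move_def fun_eq_iff sum_distrib_left)
qed (simp_all add: fun_eq_iff move_quadratic move_braid move_commute)

lemma hecke_A3_move:
  "hecke_A3 (int CARD('a))
     (move :: nat \<Rightarrow> (('a::{field,finite}, 4) flag \<Rightarrow> int) \<Rightarrow> ('a, 4) flag \<Rightarrow> int)"
  using hecke_A_move[where 'a = 'a and 'n = 4] by (simp add: hecke_A3_def)

lemma coxeter_diagonal:
  fixes F :: "('a::{field,finite}, 4) flag"
  assumes F: "F \<in> flags"
  shows "(foldr move [0..<3] ^^ n) (point_mass F) F
    = poly (coxeter_eval (monom 1 n) ! 0) (int CARD('a))"
proof -
  let ?c = "\<lambda>k. poly (coxeter_eval (monom 1 n) ! k) (int CARD('a))"
  have off_diagonal: "foldr move (normal_words ! k) (point_mass F) F = 0"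
    if "k \<in> {..<24} - {0}" for k
    using that normal_words_letter_once[of k] foldr_move_diagonal[OF F] by auto
  have "(foldr move [0..<3] ^^ n) (point_mass F) F
      = (\<Sum>k<24. ?c k * foldr move (normal_words ! k) (point_mass F) F)"
    by (simp only: hecke_A3.coxeter_funpow[OF hecke_A3_move]
        hecke_A3.word_comb_def[OF hecke_A3_move])
  also have "\<dots> = ?c 0 * foldr move (normal_words ! 0) (point_mass F) F"
    using off_diagonal by (subst sum.remove[of _ 0]) (auto intro!: sum.neutral)
  finally show ?thesis by (simp add: normal_words_0 point_mass_def)
qed

lemma poly_closed_form: "poly (closed_form p n) x = closed_form (poly p x) n"
  by (simp add: closed_form_def)

lemma closed_form_initial_values:
  assumes "n < 10"
  shows "(\<Prod>i<4. \<Sum>j<4 - i. [:0, 1:] ^ j) * coxeter_eval (monom 1 n) ! 0 = closed_form [:0, 1:] n"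
proof -
  have "n \<in> {0, 1, 2, 3, 4, 5, 6, 7, 8, 9}" using assms by auto
  then show ?thesis
    by (elim insertE emptyE) (simp_all add: lessThan_nat_numeral lessThan_Suc closed_form_def
        power_numeral_reduce numeral_poly coxeter_eval_simps)
qed

lemma coxeter_trace:
  "trace_on (flags :: ('a::{field,finite}, 4) flag set) (foldr move [0..<3] ^^ n)
    = closed_form (int CARD('a)) n"
proof (rule annihilates_unique)
  let ?q = "int CARD('a)" and ?V = "flags :: ('a, 4) flag set"
  let ?trace = "\<lambda>n. trace_on ?V (foldr move [0..<3] ^^ n)"
  show "annihilates (coxeter_poly ?q) ?trace"
    unfolding trace_on_def
    by (intro annihilates_sum hecke_A3.annihilates_coxeter[OF hecke_A3_move])
  show "annihilates (coxeter_poly ?q) (closed_form ?q)"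
    by (rule annihilates_closed_form)
  show "lead_coeff (coxeter_poly ?q) = 1"
    by (rule lead_coeff_coxeter_poly)
  show "?trace k = closed_form ?q k" if "k < degree (coxeter_poly ?q)" for k
  proof -
    have "?trace k = (\<Prod>i<4. \<Sum>j<4 - i. ?q ^ j) * poly (coxeter_eval (monom 1 k) ! 0) ?q"
      by (simp add: trace_on_def coxeter_diagonal card_flags)
    also have "\<dots> = poly ((\<Prod>i<4. \<Sum>j<4 - i. [:0, 1:] ^ j) * coxeter_eval (monom 1 k) ! 0) ?q"
      by (simp add: poly_prod poly_sum)
    also have "\<dots> = closed_form ?q k"
      using that
      by (simp only: closed_form_initial_values degree_coxeter_poly poly_closed_form) simp
    finally show ?thesis .
  qed
qed

lemma card_C4:
  assumes "n > 0"
  shows "int (card (C4 n :: ('a::{field,finite} ^ 4) set list set)) = closed_form (int CARD('a)) n"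
  using assms by (simp add: C4_eq_cyclic_bases card_cyclic_bases coxeter_trace)

lemma
  fixes n :: nat
  shows gcd_4_eq_1_iff: "gcd n 4 = 1 \<longleftrightarrow> odd n"
    and gcd_4_eq_2_iff: "gcd n 4 = 2 \<longleftrightarrow> even n \<and> \<not> 4 dvd n"
    and gcd_4_eq_4_iff: "gcd n 4 = 4 \<longleftrightarrow> 4 dvd n"
proof -
  have "gcd n 4 = 1 \<longleftrightarrow> coprime n (2 ^ 2)"
    by (simp add: coprime_iff_gcd_eq_1)
  also have "\<dots> \<longleftrightarrow> odd n"
    by (simp only: coprime_power_right_iff) simp
  finally show odd_iff: "gcd n 4 = 1 \<longleftrightarrow> odd n" .
  show four_iff: "gcd n 4 = 4 \<longleftrightarrow> 4 dvd n"
    by (metis gcd_nat.absorb_iff2)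
  have "gcd n 4 dvd 2 ^ 2" by simp
  then obtain k where "gcd n 4 = 2 ^ k" "k \<le> 2"
    using divides_primepow_nat[OF two_is_prime_nat, of "gcd n 4" 2] by blast
  moreover have "k \<in> {0, 1, 2}" using \<open>k \<le> 2\<close> by auto
  ultimately have "gcd n 4 \<in> {1, 2, 4}" by auto
  then show "gcd n 4 = 2 \<longleftrightarrow> even n \<and> \<not> 4 dvd n"
    using odd_iff four_iff by auto
qed

theorem theorem5p4:
  fixes n q :: nat
  assumes q: "q = CARD('a::{field,finite})"
    and n: "n \<ge> 4"
  shows "(gcd n 4 = 1 \<longrightarrow>
           int (card (C4 n :: ('a ^ 4) set list set)) =
             int q ^ (3 * n) - (int q ^ 3 + int q ^ 2 + int q) * int q ^ (2 * n)
             + (int q ^ 5 + int q ^ 4 + int q ^ 3) * int q ^ n - int q ^ 6) \<and>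
         (gcd n 4 = 2 \<longrightarrow>
           int (card (C4 n :: ('a ^ 4) set list set)) =
             int q ^ (3 * n) - (int q ^ 3 + int q ^ 2 + int q) * int q ^ (2 * n)
             + 2 * (int q ^ 4 + int q ^ 2) * int q ^ (3 * n div 2)
             - (int q ^ 5 + int q ^ 4 + int q ^ 3) * int q ^ n + int q ^ 6) \<and>
         (gcd n 4 = 4 \<longrightarrow>
           int (card (C4 n :: ('a ^ 4) set list set)) =
             int q ^ (3 * n) + 3 * (int q ^ 3 + int q ^ 2 + int q) * int q ^ (2 * n)
             + 2 * (int q ^ 4 + int q ^ 2) * int q ^ (3 * n div 2)
             + 3 * (int q ^ 5 + int q ^ 4 + int q ^ 3) * int q ^ n + int q ^ 6)"
proof -
  have "int (card (C4 n :: ('a ^ 4) set list set)) = closed_form (int q) n"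
    using n q by (simp add: card_C4)
  moreover have "\<not> 4 dvd n" if "odd n"
    using that by presburger
  moreover have "even n" if "4 dvd n"
    using that by presburger
  ultimately show ?thesis
    unfolding gcd_4_eq_1_iff gcd_4_eq_2_iff gcd_4_eq_4_iff
    by (auto simp: closed_form_def algebra_simps simp flip: power_mult)
qed

end
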